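(* There is no $SO(5)$-invariant Riemannian metric on $M=SO(5)/(SO(3)\times SO(2))$ with co-index of symmetry equal to $4$.
   Context: Here $SO(3)\times SO(2)\subset SO(5)$ is the standard block diagonal subgroup. Let $M$ be a compact homogeneous Riemannian manifold with Levi-Civita connection $\nabla$, and let $\mathfrak K(M)$ be the Lie algebra of all Killing vector fields on $M$ (the Lie algebra of the full isometry group $I(M)$). For $q\in M$ put $\mathfrak p^q=\{X\in\mathfrak K(M):(\nabla X)_q=0\}$ and $\mathfrak s_q=\{X_q:X\in\mathfrak p^q\}\subset T_qM$. The dimension of $\mathfrak s_q$ does not depend on $q$; it is called the index of symmetry $i_{\mathfrak s}(M)$ of $M$. The co-index of symmetry of $M$ is $\dim M-i_{\mathfrak s}(M)$. *)

theory Defs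
  imports "HOL-Analysis.Analysis" "HOL-Library.Function_Algebras"
begin

text \<open>Tangent vectors are functionals on functions, so tangent spaces are subspaces of a function
  space. This instance makes \<open>subspace\<close>, \<open>span\<close> and \<open>dim\<close> available there; addition is the pointwise
  one of \<open>Function_Algebras\<close>.\<close>

instantiation "fun" :: (type, scaleR) scaleR
begin
definition scaleR_fun :: "real \<Rightarrow> ('a \<Rightarrow> 'b) \<Rightarrow> 'a \<Rightarrow> 'b"
  where "scaleR_fun c f = (\<lambda>x. c *\<^sub>R f x)"
instance ..
end

instance "fun" :: (type, real_vector) real_vector
  by standard (simp_all add: scaleR_fun_def plus_fun_def fun_eq_iff algebra_simps)


text \<open>\<open>Ck_on k S f\<close>: \<open>f\<close> is of class \<open>C\<^sup>k\<close> on \<open>S\<close>. Only meant for open subsets \<open>S\<close> of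
  finite-dimensional spaces, where asking for \<open>C\<^sup>k\<close> directional derivatives in every fixed
  direction is the usual notion.\<close>

primrec Ck_on :: "nat \<Rightarrow> 'a::real_normed_vector set \<Rightarrow> ('a \<Rightarrow> 'b::real_normed_vector) \<Rightarrow> bool"
  where
    "Ck_on 0 S f \<longleftrightarrow> continuous_on S f"
  | "Ck_on (Suc k) S f \<longleftrightarrow> (\<forall>x\<in>S. f differentiable (at x)) \<and>
       (\<forall>v. Ck_on k S (\<lambda>x. frechet_derivative f (at x) v))"

definition smooth_on :: "'a::real_normed_vector set \<Rightarrow> ('a \<Rightarrow> 'b::real_normed_vector) \<Rightarrow> bool"
  where "smooth_on S f \<longleftrightarrow> (\<forall>k. Ck_on k S f)"


text \<open>\<open>\<real>\<^sup>5 = \<real>\<^sup>3 \<oplus> \<real>\<^sup>2\<close> is indexed by the sum type \<open>3 + 2\<close>, which has five elements, so that the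
  block decomposition is visible in the indices.\<close>

type_synonym mat5 = "real^(3+2)^(3+2)"

definition SO5 :: "mat5 set"
  where "SO5 = {a. rotation_matrix a}"

definition block_diag :: "real^3^3 \<Rightarrow> real^2^2 \<Rightarrow> mat5"
  where "block_diag b c = (\<chi> i j. case (i, j) of
           (Inl k, Inl l) \<Rightarrow> b $ k $ l
         | (Inr k, Inr l) \<Rightarrow> c $ k $ l
         | _ \<Rightarrow> 0)"

definition SO3xSO2 :: "mat5 set"
  where "SO3xSO2 = {block_diag b c |b c. rotation_matrix b \<and> rotation_matrix c}"


text \<open>The space \<open>M = SO(5)/(SO(3) \<times> SO(2))\<close> of left cosets.\<close>

type_synonym point = "mat5 set"

definition coset :: "mat5 \<Rightarrow> point"
  where "coset a = (\<lambda>h. a ** h) ` SO3xSO2"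

definition M :: "point set"
  where "M = coset ` SO5"

definition act :: "mat5 \<Rightarrow> point \<Rightarrow> point"
  where "act a q = (\<lambda>x. a ** x) ` q"


text \<open>A function on the submanifold \<open>SO5\<close> of the space of matrices is smooth iff it extends
  smoothly locally. The smooth structure of \<open>M\<close> is the quotient structure, the one making \<open>coset\<close> a
  submersion: a function on \<open>M\<close> is smooth iff its pullback to \<open>SO5\<close> is. Functions on \<open>M\<close> are total
  on \<open>point\<close>; their values outside \<open>M\<close> play no role.\<close>

definition smooth_on_SO5 :: "(mat5 \<Rightarrow> real) \<Rightarrow> bool"
  where "smooth_on_SO5 \<phi> \<longleftrightarrow>
    (\<forall>a\<in>SO5. \<exists>U F. open U \<and> a \<in> U \<and> smooth_on U F \<and> (\<forall>x\<in>U \<inter> SO5. F x = \<phi> x))"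

definition smooth_fun :: "(point \<Rightarrow> real) \<Rightarrow> bool"
  where "smooth_fun f \<longleftrightarrow> smooth_on_SO5 (\<lambda>a. f (coset a))"

definition smooth_curve :: "real \<Rightarrow> (real \<Rightarrow> point) \<Rightarrow> bool"
  where "smooth_curve \<epsilon> \<gamma> \<longleftrightarrow> \<gamma> ` {-\<epsilon><..<\<epsilon>} \<subseteq> M \<and>
    (\<forall>f. smooth_fun f \<longrightarrow> smooth_on {-\<epsilon><..<\<epsilon>} (\<lambda>t. f (\<gamma> t)))"


text \<open>A tangent vector at \<open>q\<close> is the velocity of a smooth curve through \<open>q\<close>, regarded as the
  functional sending a smooth function to its derivative along the curve. It is set to \<open>0\<close> on
  non-smooth functions, so that equality of tangent vectors is equality of functionals.\<close>

type_synonym tvector = "(point \<Rightarrow> real) \<Rightarrow> real"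

definition velocity :: "(real \<Rightarrow> point) \<Rightarrow> tvector"
  where "velocity \<gamma> = (\<lambda>f. if smooth_fun f then deriv (\<lambda>t. f (\<gamma> t)) 0 else 0)"

definition tangent_space :: "point \<Rightarrow> tvector set"
  where "tangent_space q = {velocity \<gamma> |\<gamma> \<epsilon>. \<epsilon> > 0 \<and> smooth_curve \<epsilon> \<gamma> \<and> \<gamma> 0 = q}"

definition push_forward :: "mat5 \<Rightarrow> tvector \<Rightarrow> tvector"
  where "push_forward a u = (\<lambda>f. u (\<lambda>p. f (act a p)))"

definition vector_field :: "(point \<Rightarrow> tvector) \<Rightarrow> bool"
  where "vector_field X \<longleftrightarrow> (\<forall>q\<in>M. X q \<in> tangent_space q) \<and>
    (\<forall>f. smooth_fun f \<longrightarrow> smooth_fun (\<lambda>q. X q f))"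

definition lie_bracket :: "(point \<Rightarrow> tvector) \<Rightarrow> (point \<Rightarrow> tvector) \<Rightarrow> point \<Rightarrow> tvector"
  where "lie_bracket X Y q = (\<lambda>f. X q (\<lambda>p. Y p f) - Y q (\<lambda>p. X p f))"


type_synonym metric = "point \<Rightarrow> tvector \<Rightarrow> tvector \<Rightarrow> real"

definition riemannian_metric :: "metric \<Rightarrow> bool"
  where "riemannian_metric g \<longleftrightarrow>
    (\<forall>q\<in>M. \<forall>u\<in>tangent_space q. \<forall>v\<in>tangent_space q.
       g q u v = g q v u \<and>
       (\<forall>w\<in>tangent_space q. g q (u + v) w = g q u w + g q v w) \<and>
       (\<forall>c. g q (c *\<^sub>R u) v = c * g q u v) \<and>
       (u \<noteq> 0 \<longrightarrow> g q u u > 0)) \<and>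
    (\<forall>X Y. vector_field X \<longrightarrow> vector_field Y \<longrightarrow> smooth_fun (\<lambda>q. g q (X q) (Y q)))"

definition SO5_invariant :: "metric \<Rightarrow> bool"
  where "SO5_invariant g \<longleftrightarrow>
    (\<forall>a\<in>SO5. \<forall>q\<in>M. \<forall>u\<in>tangent_space q. \<forall>v\<in>tangent_space q.
       g (act a q) (push_forward a u) (push_forward a v) = g q u v)"


text \<open>For a connection \<open>D\<close>, \<open>D q u Y\<close> is the covariant derivative of \<open>Y\<close> at \<open>q\<close> in the direction
  \<open>u \<in> T\<^sub>qM\<close>.\<close>

type_synonym connection = "point \<Rightarrow> tvector \<Rightarrow> (point \<Rightarrow> tvector) \<Rightarrow> tvector"

definition affine_connection :: "connection \<Rightarrow> bool"
  where "affine_connection D \<longleftrightarrow>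
    (\<forall>q\<in>M. \<forall>u\<in>tangent_space q. \<forall>Y. vector_field Y \<longrightarrow>
       D q u Y \<in> tangent_space q \<and>
       (\<forall>v\<in>tangent_space q. D q (u + v) Y = D q u Y + D q v Y) \<and>
       (\<forall>c. D q (c *\<^sub>R u) Y = c *\<^sub>R D q u Y) \<and>
       (\<forall>Z. vector_field Z \<longrightarrow> D q u (\<lambda>p. Y p + Z p) = D q u Y + D q u Z) \<and>
       (\<forall>f. smooth_fun f \<longrightarrow> D q u (\<lambda>p. f p *\<^sub>R Y p) = u f *\<^sub>R Y q + f q *\<^sub>R D q u Y)) \<and>
    (\<forall>X Y. vector_field X \<longrightarrow> vector_field Y \<longrightarrow> vector_field (\<lambda>q. D q (X q) Y))"

definition torsion_free :: "connection \<Rightarrow> bool"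
  where "torsion_free D \<longleftrightarrow>
    (\<forall>X Y. vector_field X \<longrightarrow> vector_field Y \<longrightarrow>
       (\<forall>q\<in>M. D q (X q) Y - D q (Y q) X = lie_bracket X Y q))"

definition metric_compatible :: "metric \<Rightarrow> connection \<Rightarrow> bool"
  where "metric_compatible g D \<longleftrightarrow>
    (\<forall>q\<in>M. \<forall>u\<in>tangent_space q. \<forall>Y Z. vector_field Y \<longrightarrow> vector_field Z \<longrightarrow>
       u (\<lambda>p. g p (Y p) (Z p)) = g q (D q u Y) (Z q) + g q (Y q) (D q u Z))"

text \<open>By the fundamental theorem of Riemannian geometry, such a connection exists and its values on
  tangent vectors and vector fields are unique; the choice only concerns irrelevant arguments.\<close>

definition levi_civita :: "metric \<Rightarrow> connection"
  where "levi_civita g =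
    (SOME D. affine_connection D \<and> torsion_free D \<and> metric_compatible g D)"


text \<open>Killing fields are the vector fields \<open>X\<close> with \<open>L\<^sub>X g = 0\<close>. As \<open>M\<close> is compact they are complete,
  hence form the Lie algebra of the full isometry group.\<close>

definition killing_field :: "metric \<Rightarrow> (point \<Rightarrow> tvector) \<Rightarrow> bool"
  where "killing_field g X \<longleftrightarrow> vector_field X \<and>
    (\<forall>Y Z. vector_field Y \<longrightarrow> vector_field Z \<longrightarrow>
       (\<forall>q\<in>M. X q (\<lambda>p. g p (Y p) (Z p)) =
              g q (lie_bracket X Y q) (Z q) + g q (Y q) (lie_bracket X Z q)))"

definition transvections :: "metric \<Rightarrow> point \<Rightarrow> (point \<Rightarrow> tvector) set"
  where "transvections g q =
    {X. killing_field g X \<and> (\<forall>u\<in>tangent_space q. levi_civita g q u X = 0)}"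

definition symmetric_subspace :: "metric \<Rightarrow> point \<Rightarrow> tvector set"
  where "symmetric_subspace g q = (\<lambda>X. X q) ` transvections g q"

definition index_of_symmetry :: "metric \<Rightarrow> point \<Rightarrow> nat"
  where "index_of_symmetry g q = dim (symmetric_subspace g q)"

definition coindex_of_symmetry :: "metric \<Rightarrow> point \<Rightarrow> int"
  where "coindex_of_symmetry g q = int (dim (tangent_space q)) - int (index_of_symmetry g q)"

end

theory Submission
  imports Defs
begin

text \<open>\<open>M\<close> is a Riemannian symmetric space for every invariant metric, so the index of symmetry is the
  full dimension and the co-index is \<open>0\<close>. Concretely, \<open>M\<close> is the adjoint orbit of a matrix \<open>J\<close>. At each
  point \<open>q\<close> the fundamental fields of \<open>so(5)\<close> split into those of the isotropy algebra, which vanish at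
  \<open>q\<close>, and those of a complement isomorphic to \<open>T\<^sub>qM\<close>, on which two elements commute up to the
  isotropy algebra. Differentiating the complement-valued function that represents a vector field gives
  a torsion-free connection, which invariance makes metric, so it is the Levi-Civita connection. For it
  the Killing fields from the complement at \<open>q\<close> are parallel at \<open>q\<close>, and they fill \<open>T\<^sub>qM\<close>.\<close>

section \<open>Calculus of smooth maps\<close>

text \<open>The definitions speak of velocities of arbitrary smooth curves, of functions whose
  smoothness is known only through local extensions to matrices, and of a connection chosen by
  \<open>SOME\<close>; most of the work is to reach matrix algebra from there. The hard step is that
  every tangent vector is a fundamental one: a curve in \<open>M\<close> has to be lifted
  differentiably to the group, which an explicit local section of the map from \<open>a\<close> to
  \<open>conj_mat a J\<close> achieves. The matrix \<open>J\<close> generates the Lie algebra of the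
  SO(2) factor, and its stabilizer in SO(5) is exactly SO(3) x SO(2), without further components.
  Its adjoint action squares to -1 on off-diagonal skew matrices and kills block-diagonal ones, so
  -(ad J)^2 is the projection onto the complement; carried around by conjugation, it becomes the
  form \<open>theta\<close>, smooth on all of \<open>M\<close>. Curves in the group with prescribed
  velocity are products of explicit plane rotations instead of exponentials.\<close>

lemma has_derivative_frechet:
  "f differentiable (at x) \<Longrightarrow> (f has_derivative frechet_derivative f (at x)) (at x)"
  by (simp add: frechet_derivative_works)

lemma frechet_derivative_eqI:
  "(f has_derivative f') (at x) \<Longrightarrow> frechet_derivative f (at x) = f'"
  using frechet_derivative_at by metis

lemma differentiable_cong_open:
  assumes "open S" "x \<in> S" "\<And>y. y \<in> S \<Longrightarrow> f y = g y"
  shows "f differentiable (at x) \<longleftrightarrow> g differentiable (at x)"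
    and "frechet_derivative f (at x) = frechet_derivative g (at x)"
proof -
  have e: "(f has_derivative D) (at x) \<longleftrightarrow> (g has_derivative D) (at x)" for D
    using has_derivative_transform_within_open[of f D x UNIV S g]
      has_derivative_transform_within_open[of g D x UNIV S f] assms by auto
  show "f differentiable (at x) \<longleftrightarrow> g differentiable (at x)"
    by (simp add: differentiable_def e)
  show "frechet_derivative f (at x) = frechet_derivative g (at x)"
    by (simp add: frechet_derivative_def e)
qed

lemma Ck_on_cong:
  assumes "open S" "\<And>x. x \<in> S \<Longrightarrow> f x = g x"
  shows "Ck_on k S f \<longleftrightarrow> Ck_on k S g"
  using assms(2)
proof (induction k arbitrary: f g)
  case 0 then show ?case by (simp cong: continuous_on_cong)
next
  case (Suc k)
  have "Ck_on k S (\<lambda>x. frechet_derivative f (at x) v) \<longleftrightarrow> Ck_on k S (\<lambda>x. frechet_derivative g (at x) v)" for v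
    by (rule Suc.IH) (metis differentiable_cong_open(2)[OF assms(1)] Suc.prems)
  moreover have "(\<forall>x\<in>S. f differentiable (at x)) \<longleftrightarrow> (\<forall>x\<in>S. g differentiable (at x))"
    by (intro ball_cong refl differentiable_cong_open(1)[OF assms(1)] Suc.prems)
  ultimately show ?case unfolding Ck_on.simps by simp
qed

text \<open>Extensions of functions on the group exist only locally, so smoothness along a curve has
  to be glued from small intervals.\<close>

lemma Ck_on_local:
  assumes "\<And>x. x \<in> S \<Longrightarrow> \<exists>U. open U \<and> x \<in> U \<and> Ck_on k U f"
  shows "Ck_on k S f"
  using assms
proof (induction k arbitrary: f)
  case 0
  then show ?case
    by (simp add: continuous_on_eq_continuous_at)
       (metis continuous_at_imp_continuous_at_within continuous_on_eq_continuous_at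
          continuous_on_eq_continuous_within)
next
  case (Suc k)
  have "Ck_on k S (\<lambda>x. frechet_derivative f (at x) v)" for v
    by (rule Suc.IH) (use Suc.prems in fastforce)
  then show ?case using Suc.prems by fastforce
qed

lemma Ck_on_subset: "Ck_on k S f \<Longrightarrow> T \<subseteq> S \<Longrightarrow> Ck_on k T f"
  by (induction k arbitrary: f) (auto intro: continuous_on_subset)

text \<open>The successor clause of \<open>Ck_on\<close> does not ask for continuity of
  \<open>f\<close> itself; differentiability supplies it in the base case.\<close>

lemma Ck_on_SucD: "Ck_on (Suc k) S f \<Longrightarrow> Ck_on k S f"
proof (induction k arbitrary: f)
  case 0
  then show ?case
    by (auto intro!: continuous_at_imp_continuous_on dest: differentiable_imp_continuous_within)
next
  case (Suc k)
  then show ?case by (metis Ck_on.simps(2))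
qed

lemma Ck_on_const [simp]: "Ck_on k S (\<lambda>x. c)"
  by (induction k arbitrary: c) auto

lemma Ck_on_bounded_linear:
  assumes "bounded_linear f" shows "Ck_on k S f"
proof (cases k)
  case 0 then show ?thesis
    by (simp add: linear_continuous_on assms)
next
  case (Suc k)
  have "frechet_derivative f (at x) = f" for x
    by (rule frechet_derivative_eqI) (rule bounded_linear_imp_has_derivative[OF assms])
  then show ?thesis
    using Suc bounded_linear_imp_differentiable[OF assms] by simp
qed

lemma Ck_on_bounded_linear_compose:
  assumes "open S" "bounded_linear L" "Ck_on k S f" shows "Ck_on k S (\<lambda>x. L (f x))"
  using assms(3)
proof (induction k arbitrary: f)
  case 0
  then show ?case
    by (simp add: bounded_linear.continuous_on[OF assms(2)])
next
  case (Suc k)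
  have d: "((\<lambda>x. L (f x)) has_derivative (\<lambda>v. L (frechet_derivative f (at x) v))) (at x)"
    if "x \<in> S" for x
    by (rule bounded_linear.has_derivative[OF assms(2) has_derivative_frechet]) (use Suc.prems that in auto)
  have "Ck_on k S (\<lambda>x. frechet_derivative (\<lambda>x. L (f x)) (at x) v)" for v
  proof -
    have "Ck_on k S (\<lambda>x. L (frechet_derivative f (at x) v))"
      using Suc by simp
    then show ?thesis
      by (subst Ck_on_cong[OF assms(1)]) (simp_all add: frechet_derivative_eqI[OF d])
  qed
  then show ?case using differentiableI[OF d] by simp
qed

lemma Ck_on_add:
  assumes "open S" "Ck_on k S f" "Ck_on k S g" shows "Ck_on k S (\<lambda>x. f x + g x)"
  using assms(2,3)
proof (induction k arbitrary: f g)
  case 0 then show ?case by (simp add: continuous_on_add)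
next
  case (Suc k)
  have d: "((\<lambda>x. f x + g x) has_derivative
      (\<lambda>v. frechet_derivative f (at x) v + frechet_derivative g (at x) v)) (at x)"
    if "x \<in> S" for x
    by (rule has_derivative_add[OF has_derivative_frechet has_derivative_frechet]) (use Suc.prems that in auto)
  have "Ck_on k S (\<lambda>x. frechet_derivative (\<lambda>x. f x + g x) (at x) v)" for v
  proof -
    have "Ck_on k S (\<lambda>x. frechet_derivative f (at x) v + frechet_derivative g (at x) v)"
      using Suc by simp
    then show ?thesis
      by (subst Ck_on_cong[OF assms(1)]) (simp_all add: frechet_derivative_eqI[OF d])
  qed
  then show ?case using differentiableI[OF d] by simp
qed

lemma Ck_on_sum:
  assumes "open S" "finite I" "\<And>i. i \<in> I \<Longrightarrow> Ck_on k S (f i)"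
  shows "Ck_on k S (\<lambda>x. \<Sum>i\<in>I. f i x)"
  using assms(2,3) by (induction I) (auto intro!: Ck_on_add[OF assms(1)])

lemma Ck_on_bilinear:
  assumes "open S" "bounded_bilinear p" "Ck_on k S f" "Ck_on k S g"
  shows "Ck_on k S (\<lambda>x. p (f x) (g x))"
  using assms(3,4)
proof (induction k arbitrary: f g)
  case 0 then show ?case by (simp add: bounded_bilinear.continuous_on[OF assms(2)])
next
  case (Suc k)
  have d: "((\<lambda>x. p (f x) (g x)) has_derivative
      (\<lambda>v. p (f x) (frechet_derivative g (at x) v) + p (frechet_derivative f (at x) v) (g x))) (at x)"
    if "x \<in> S" for x
    by (rule bounded_bilinear.FDERIV[OF assms(2) has_derivative_frechet has_derivative_frechet]) (use Suc.prems that in auto)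
  have "Ck_on k S (\<lambda>x. frechet_derivative (\<lambda>x. p (f x) (g x)) (at x) v)" for v
  proof -
    have "Ck_on k S (\<lambda>x. p (f x) (frechet_derivative g (at x) v) + p (frechet_derivative f (at x) v) (g x))"
      by (intro Ck_on_add[OF assms(1)] Suc.IH Ck_on_SucD[OF Suc.prems(1)] Ck_on_SucD[OF Suc.prems(2)])
        (use Suc.prems in auto)
    then show ?thesis
      by (subst Ck_on_cong[OF assms(1)]) (simp_all add: frechet_derivative_eqI[OF d])
  qed
  then show ?case using differentiableI[OF d] by simp
qed

text \<open>\<open>Ck_on\<close> controls derivatives in fixed directions only. Where the direction
  depends on the point, this expansion reduces to the finitely many fixed directions in
  \<open>Basis\<close>.\<close>

lemma linear_frechet_euclidean:
  fixes g :: "'b::euclidean_space \<Rightarrow> 'c::real_normed_vector"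
  assumes "g differentiable (at y)"
  shows "frechet_derivative g (at y) v =
    (\<Sum>b\<in>Basis. (v \<bullet> b) *\<^sub>R frechet_derivative g (at y) b)"
proof -
  have l: "linear (frechet_derivative g (at y))"
    using assms by (rule linear_frechet_derivative)
  have "frechet_derivative g (at y) v = frechet_derivative g (at y) (\<Sum>b\<in>Basis. (v \<bullet> b) *\<^sub>R b)"
    by (simp add: euclidean_representation)
  then show ?thesis
    by (simp add: linear_sum[OF l] linear_cmul[OF l])
qed

lemma Ck_on_compose:
  fixes f :: "'a::real_normed_vector \<Rightarrow> 'b::euclidean_space"
  assumes "open S" "f ` S \<subseteq> T" "Ck_on k S f" "Ck_on k T g"
  shows "Ck_on k S (\<lambda>x. g (f x))"
  using assms(3,4)
proof (induction k arbitrary: g)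
  case 0 then show ?case
    using continuous_on_compose2 assms(2) by (auto simp: image_subset_iff)
next
  case (Suc k)
  have fT: "f x \<in> T" if "x \<in> S" for x using assms(2) that by auto
  have d: "((\<lambda>x. g (f x)) has_derivative
      (\<lambda>v. frechet_derivative g (at (f x)) (frechet_derivative f (at x) v))) (at x)"
    if "x \<in> S" for x
    by (rule has_derivative_compose[OF has_derivative_frechet has_derivative_frechet])
       (use Suc.prems that fT in auto)
  have "Ck_on k S (\<lambda>x. frechet_derivative (\<lambda>x. g (f x)) (at x) v)" for v
  proof -
    \<comment> \<open>The chain rule differentiates \<open>g\<close> in the moving direction
      \<open>frechet_derivative f (at x) v\<close>; expanded over \<open>Basis\<close> of the middle
      space, each summand is a product covered by the induction hypothesis.\<close>
    have "Ck_on k S (\<lambda>x. \<Sum>b\<in>Basis. (frechet_derivative f (at x) v \<bullet> b) *\<^sub>R frechet_derivative g (at (f x)) b)"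
      by (intro Ck_on_sum[OF assms(1)] Ck_on_bilinear[OF assms(1) bounded_bilinear_scaleR]
          Ck_on_bounded_linear_compose[OF assms(1) bounded_linear_inner_left] Suc.IH
          Ck_on_SucD[OF Suc.prems(1)] finite_Basis) (use Suc.prems in auto)
    moreover have "frechet_derivative g (at (f x)) (frechet_derivative f (at x) v) =
        (\<Sum>b\<in>Basis. (frechet_derivative f (at x) v \<bullet> b) *\<^sub>R frechet_derivative g (at (f x)) b)"
      if "x \<in> S" for x
      by (rule linear_frechet_euclidean) (use Suc.prems fT[OF that] in auto)
    ultimately show ?thesis
      by (subst Ck_on_cong[OF assms(1)]) (simp_all add: frechet_derivative_eqI[OF d])
  qed
  then show ?case using differentiableI[OF d] by simp
qed

lemma smooth_on_cong: "open S \<Longrightarrow> (\<And>x. x \<in> S \<Longrightarrow> f x = g x) \<Longrightarrow> smooth_on S f \<longleftrightarrow> smooth_on S g"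
  unfolding smooth_on_def by (intro iff_allI Ck_on_cong)

lemma smooth_on_subset: "smooth_on S f \<Longrightarrow> T \<subseteq> S \<Longrightarrow> smooth_on T f"
  unfolding smooth_on_def by (auto intro: Ck_on_subset)

lemma smooth_on_local:
  assumes "\<And>x. x \<in> S \<Longrightarrow> \<exists>U. open U \<and> x \<in> U \<and> smooth_on U f"
  shows "smooth_on S f"
  unfolding smooth_on_def
proof
  fix k show "Ck_on k S f"
  proof (rule Ck_on_local)
    fix x assume "x \<in> S"
    from assms[OF this] obtain U where "open U" "x \<in> U" "smooth_on U f" by blast
    then show "\<exists>U. open U \<and> x \<in> U \<and> Ck_on k U f"
      unfolding smooth_on_def by (intro exI[of _ U]) simp
  qed
qed

lemma smooth_on_const: "smooth_on S (\<lambda>x. c)"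
  by (simp add: smooth_on_def)

lemma smooth_on_bounded_linear: "bounded_linear f \<Longrightarrow> smooth_on S f"
  by (simp add: smooth_on_def Ck_on_bounded_linear)

lemma smooth_on_bounded_linear_compose:
  "open S \<Longrightarrow> bounded_linear L \<Longrightarrow> smooth_on S f \<Longrightarrow> smooth_on S (\<lambda>x. L (f x))"
  by (simp add: smooth_on_def Ck_on_bounded_linear_compose)

lemma smooth_on_add: "open S \<Longrightarrow> smooth_on S f \<Longrightarrow> smooth_on S g \<Longrightarrow> smooth_on S (\<lambda>x. f x + g x)"
  by (simp add: smooth_on_def Ck_on_add)

lemma smooth_on_sum:
  "open S \<Longrightarrow> finite I \<Longrightarrow> (\<And>i. i \<in> I \<Longrightarrow> smooth_on S (f i)) \<Longrightarrow> smooth_on S (\<lambda>x. \<Sum>i\<in>I. f i x)"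
  by (simp add: smooth_on_def Ck_on_sum)

lemma smooth_on_bilinear:
  "open S \<Longrightarrow> bounded_bilinear p \<Longrightarrow> smooth_on S f \<Longrightarrow> smooth_on S g \<Longrightarrow>
    smooth_on S (\<lambda>x. p (f x) (g x))"
  by (simp add: smooth_on_def Ck_on_bilinear)

lemma smooth_on_compose:
  fixes f :: "'a::real_normed_vector \<Rightarrow> 'b::euclidean_space"
  assumes "open S" "f ` S \<subseteq> T" "smooth_on S f" "smooth_on T g"
  shows "smooth_on S (\<lambda>x. g (f x))"
  unfolding smooth_on_def
proof
  fix k show "Ck_on k S (\<lambda>x. g (f x))"
    by (rule Ck_on_compose[OF assms(1,2)]) (use assms(3,4) in \<open>simp_all add: smooth_on_def\<close>)
qed

lemma smooth_on_differentiable: "smooth_on S f \<Longrightarrow> x \<in> S \<Longrightarrow> f differentiable (at x)"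
  unfolding smooth_on_def by (drule spec[of _ "Suc 0"]) simp

lemma smooth_on_derivative: "smooth_on S f \<Longrightarrow> smooth_on S (\<lambda>x. frechet_derivative f (at x) v)"
  unfolding smooth_on_def
proof
  fix k assume "\<forall>k. Ck_on k S f"
  then have "Ck_on (Suc k) S f" ..
  then show "Ck_on k S (\<lambda>x. frechet_derivative f (at x) v)" by simp
qed

lemma smooth_on_derivative_along:
  fixes f :: "'a::euclidean_space \<Rightarrow> 'b::real_normed_vector"
  assumes "open S" "smooth_on S f" "bounded_linear L"
  shows "smooth_on S (\<lambda>x. frechet_derivative f (at x) (L x))"
proof -
  have "smooth_on S (\<lambda>x. \<Sum>b\<in>Basis. (L x \<bullet> b) *\<^sub>R frechet_derivative f (at x) b)"
    using assms
    by (intro smooth_on_sum smooth_on_bilinear[OF _ bounded_bilinear_scaleR] smooth_on_derivative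
        smooth_on_bounded_linear_compose[OF _ bounded_linear_inner_left]
        smooth_on_bounded_linear[OF assms(3)]) auto
  then show ?thesis
    by (subst smooth_on_cong[OF assms(1)])
       (auto intro!: linear_frechet_euclidean smooth_on_differentiable[OF assms(2)])
qed

lemma smooth_on_imp_continuous: "smooth_on S f \<Longrightarrow> continuous_on S f"
  unfolding smooth_on_def by (drule spec[of _ 0]) simp

lemma smooth_on_sin_cos: "smooth_on UNIV (sin :: real \<Rightarrow> real)" "smooth_on UNIV (cos :: real \<Rightarrow> real)"
proof -
  \<comment> \<open>Proved together, since each derivative is the other function up to sign.\<close>
  have "Ck_on k UNIV (sin :: real \<Rightarrow> real) \<and> Ck_on k UNIV (cos :: real \<Rightarrow> real)" for k
  proof (induction k)
    case 0 then show ?case by (auto intro: continuous_intros)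
  next
    case (Suc k)
    have s: "(sin has_derivative (\<lambda>v. v * cos x)) (at x)" for x :: real
      by (auto intro!: derivative_eq_intros)
    have c: "(cos has_derivative (\<lambda>v. (- v) * sin x)) (at x)" for x :: real
      by (auto intro!: derivative_eq_intros)
    have m: "Ck_on k UNIV (\<lambda>x. c * f x)" if "Ck_on k UNIV f" for c :: real and f :: "real \<Rightarrow> real"
      by (rule Ck_on_bounded_linear_compose[OF open_UNIV bounded_linear_mult_right that])
    have sc: "Ck_on k UNIV (sin :: real \<Rightarrow> real)" "Ck_on k UNIV (cos :: real \<Rightarrow> real)"
      using Suc by auto
    show ?case
      unfolding Ck_on.simps frechet_derivative_eqI[OF s] frechet_derivative_eqI[OF c]
      by (intro conjI allI ballI m sc differentiableI[OF s] differentiableI[OF c])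
  qed
  then show "smooth_on UNIV (sin :: real \<Rightarrow> real)" "smooth_on UNIV (cos :: real \<Rightarrow> real)"
    by (simp_all add: smooth_on_def)
qed

section \<open>Symmetry of second derivatives\<close>

lemma second_difference_mvt:
  fixes F :: "'a::real_normed_vector \<Rightarrow> real"
  assumes U: "open U" "smooth_on U F" and h: "h > 0"
    and sub: "\<And>s t. 0 \<le> s \<Longrightarrow> s \<le> h \<Longrightarrow> 0 \<le> t \<Longrightarrow> t \<le> h \<Longrightarrow> a + s *\<^sub>R v + t *\<^sub>R w \<in> U"
  shows "\<exists>s t. 0 < s \<and> s < h \<and> 0 < t \<and> t < h \<and>
    F (a + h *\<^sub>R v + h *\<^sub>R w) - F (a + h *\<^sub>R v) - F (a + h *\<^sub>R w) + F a =
    h * h * frechet_derivative (\<lambda>x. frechet_derivative F (at x) v) (at (a + s *\<^sub>R v + t *\<^sub>R w)) w"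
proof -
  let ?G = "\<lambda>x. frechet_derivative F (at x) v"
  have dF: "(F has_derivative frechet_derivative F (at x)) (at x)" if "x \<in> U" for x
    using that U(2) smooth_on_differentiable has_derivative_frechet by blast
  have dG: "(?G has_derivative frechet_derivative ?G (at x)) (at x)" if "x \<in> U" for x
    using that U(2) smooth_on_derivative smooth_on_differentiable has_derivative_frechet by blast
  \<comment> \<open>The second difference is \<open>\<phi> h - \<phi> 0\<close>; the mean value
    theorem in \<open>s\<close>, then in \<open>t\<close>, turns it into a mixed derivative at an
    intermediate point.\<close>
  define \<phi> where "\<phi> s = F (a + s *\<^sub>R v + h *\<^sub>R w) - F (a + s *\<^sub>R v)" for s
  have d1: "DERIV (\<lambda>s. F (a + s *\<^sub>R v + t *\<^sub>R w)) s :> ?G (a + s *\<^sub>R v + t *\<^sub>R w)"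
    if "0 \<le> s" "s \<le> h" "0 \<le> t" "t \<le> h" for s t
  proof -
    have i: "((\<lambda>s. a + s *\<^sub>R v + t *\<^sub>R w) has_derivative (\<lambda>r. r *\<^sub>R v)) (at s)"
      by (auto intro!: derivative_eq_intros)
    have "((\<lambda>s. F (a + s *\<^sub>R v + t *\<^sub>R w)) has_derivative
        (\<lambda>r. frechet_derivative F (at (a + s *\<^sub>R v + t *\<^sub>R w)) (r *\<^sub>R v))) (at s)"
      using has_derivative_compose[OF i dF] sub that by simp
    then show ?thesis
      using linear_cmul[OF linear_frechet_derivative[of F "at (a + s *\<^sub>R v + t *\<^sub>R w)"]]
        differentiableI[OF dF[OF sub[OF that]]]
      by (simp add: has_field_derivative_def mult_commute_abs)
  qed
  have "\<exists>s. 0 < s \<and> s < h \<and> \<phi> h - \<phi> 0 = (h - 0) * (?G (a + s *\<^sub>R v + h *\<^sub>R w) - ?G (a + s *\<^sub>R v))"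
    unfolding \<phi>_def using h
    by (intro MVT2) (use d1[where t=h] d1[where t=0] in \<open>auto intro!: DERIV_diff\<close>)
  then obtain s where s: "0 < s" "s < h"
    "\<phi> h - \<phi> 0 = h * (?G (a + s *\<^sub>R v + h *\<^sub>R w) - ?G (a + s *\<^sub>R v))" by auto
  have d2: "DERIV (\<lambda>t. ?G (a + s *\<^sub>R v + t *\<^sub>R w)) t :> frechet_derivative ?G (at (a + s *\<^sub>R v + t *\<^sub>R w)) w"
    if "0 \<le> t" "t \<le> h" for t
  proof -
    have u: "a + s *\<^sub>R v + t *\<^sub>R w \<in> U" using sub s that by auto
    have i: "((\<lambda>t. a + s *\<^sub>R v + t *\<^sub>R w) has_derivative (\<lambda>r. r *\<^sub>R w)) (at t)"
      by (auto intro!: derivative_eq_intros)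
    have "((\<lambda>t. ?G (a + s *\<^sub>R v + t *\<^sub>R w)) has_derivative
        (\<lambda>r. frechet_derivative ?G (at (a + s *\<^sub>R v + t *\<^sub>R w)) (r *\<^sub>R w))) (at t)"
      using has_derivative_compose[OF i dG[OF u]] by simp
    then show ?thesis
      using linear_cmul[OF linear_frechet_derivative[of ?G "at (a + s *\<^sub>R v + t *\<^sub>R w)"]]
        differentiableI[OF dG[OF u]]
      by (simp add: has_field_derivative_def mult_commute_abs)
  qed
  have "\<exists>t. 0 < t \<and> t < h \<and> ?G (a + s *\<^sub>R v + h *\<^sub>R w) - ?G (a + s *\<^sub>R v + 0 *\<^sub>R w) =
      (h - 0) * frechet_derivative ?G (at (a + s *\<^sub>R v + t *\<^sub>R w)) w"
    using h by (intro MVT2) (use d2 in auto)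
  then obtain t where "0 < t" "t < h" "?G (a + s *\<^sub>R v + h *\<^sub>R w) - ?G (a + s *\<^sub>R v) =
      h * frechet_derivative ?G (at (a + s *\<^sub>R v + t *\<^sub>R w)) w" by auto
  with s show ?thesis unfolding \<phi>_def by (intro exI[of _ s] exI[of _ t]) simp
qed

lemma second_difference_limit:
  fixes F :: "'a::real_normed_vector \<Rightarrow> real"
  assumes U: "open U" "a \<in> U" "smooth_on U F"
  shows "((\<lambda>h. (F (a + h *\<^sub>R v + h *\<^sub>R w) - F (a + h *\<^sub>R v) - F (a + h *\<^sub>R w) + F a) / (h * h)) \<longlongrightarrow>
     frechet_derivative (\<lambda>x. frechet_derivative F (at x) v) (at a) w) (at_right 0)"
proof (rule tendstoI)
  let ?H = "\<lambda>x. frechet_derivative (\<lambda>x. frechet_derivative F (at x) v) (at x) w"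
  fix e :: real assume e: "e > 0"
  have "continuous_on U ?H"
    using U(3) by (intro smooth_on_imp_continuous smooth_on_derivative)
  then have "isCont ?H a" using U by (simp add: continuous_on_eq_continuous_at)
  then obtain d0 where d0: "d0 > 0" "\<And>x. dist x a < d0 \<Longrightarrow> dist (?H x) (?H a) < e"
    using e unfolding continuous_at_eps_delta by blast
  obtain d1 where d1: "d1 > 0" "ball a d1 \<subseteq> U" using U by (meson openE)
  \<comment> \<open>Keeps the parallelogram within distance \<open>min d0 d1\<close> of
    \<open>a\<close>; the summand 1 covers \<open>v = w = 0\<close>.\<close>
  define d where "d = min d0 d1 / (norm v + norm w + 1)"
  have d: "d > 0" unfolding d_def using d0 d1 by (auto intro!: divide_pos_pos add_nonneg_pos)
  have near: "dist (a + s *\<^sub>R v + t *\<^sub>R w) a < min d0 d1"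
    if "0 \<le> s" "s < d" "0 \<le> t" "t < d" for s t
  proof -
    have "dist (a + s *\<^sub>R v + t *\<^sub>R w) a \<le> s * norm v + t * norm w"
      using that norm_triangle_ineq[of "s *\<^sub>R v" "t *\<^sub>R w"] by (simp add: dist_norm algebra_simps)
    also have "\<dots> \<le> d * norm v + d * norm w"
      using that by (intro add_mono mult_right_mono) auto
    also have "\<dots> < d * (norm v + norm w + 1)" using d by (simp add: algebra_simps)
    also have "\<dots> = min d0 d1"
      unfolding d_def using norm_ge_zero[of v] norm_ge_zero[of w]
      by (simp add: add_nonneg_pos less_imp_neq[THEN not_sym])
    finally show ?thesis .
  qed
  have "dist ((F (a + h *\<^sub>R v + h *\<^sub>R w) - F (a + h *\<^sub>R v) - F (a + h *\<^sub>R w) + F a) / (h * h)) (?H a) < e"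
    if h: "0 < h" "h < d" for h
  proof -
    have sub: "a + s *\<^sub>R v + t *\<^sub>R w \<in> U" if "0 \<le> s" "s \<le> h" "0 \<le> t" "t \<le> h" for s t
    proof -
      have "a + s *\<^sub>R v + t *\<^sub>R w \<in> ball a d1"
        using near[of s t] that h by (simp add: dist_commute)
      then show ?thesis using d1 by blast
    qed
    obtain s t where st: "0 < s" "s < h" "0 < t" "t < h"
      "F (a + h *\<^sub>R v + h *\<^sub>R w) - F (a + h *\<^sub>R v) - F (a + h *\<^sub>R w) + F a =
        h * h * ?H (a + s *\<^sub>R v + t *\<^sub>R w)"
      using second_difference_mvt[OF U(1,3) h(1) sub] by blast
    have "dist (?H (a + s *\<^sub>R v + t *\<^sub>R w)) (?H a) < e"
      using near[of s t] st h by (intro d0) auto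
    then show ?thesis using st h by simp
  qed
  then show "\<forall>\<^sub>F h in at_right 0.
      dist ((F (a + h *\<^sub>R v + h *\<^sub>R w) - F (a + h *\<^sub>R v) - F (a + h *\<^sub>R w) + F a) / (h * h)) (?H a) < e"
    unfolding eventually_at_right_field using d by blast
qed

text \<open>The second difference does not change when \<open>v\<close> and \<open>w\<close> are
  exchanged, so both mixed derivatives are limits of the same quotient. This cancels the
  second-order terms in \<open>fund_bracket\<close>.\<close>

lemma second_derivative_symmetric:
  fixes F :: "'a::real_normed_vector \<Rightarrow> real"
  assumes U: "open U" "a \<in> U" "smooth_on U F"
  shows "frechet_derivative (\<lambda>x. frechet_derivative F (at x) v) (at a) w =
    frechet_derivative (\<lambda>x. frechet_derivative F (at x) w) (at a) v"
proof -
  let ?Q = "\<lambda>v w h. (F (a + h *\<^sub>R v + h *\<^sub>R w) - F (a + h *\<^sub>R v) - F (a + h *\<^sub>R w) + F a) / (h * h)"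
  have "?Q w v = ?Q v w" by (auto simp: fun_eq_iff algebra_simps)
  then show ?thesis
    using tendsto_unique[OF trivial_limit_at_right_real second_difference_limit[OF U, of v w]]
      second_difference_limit[OF U, of w v] by simp
qed

section \<open>Matrices\<close>

lemma bounded_bilinear_matrix_mult:
  "bounded_bilinear ((**) :: real^'n^'m \<Rightarrow> real^'k^'n \<Rightarrow> real^'k^'m)"
proof -
  have "bilinear ((**) :: real^'n^'m \<Rightarrow> real^'k^'n \<Rightarrow> real^'k^'m)"
    unfolding bilinear_def
    by (auto intro!: linearI simp: matrix_matrix_mult_def vec_eq_iff sum.distrib sum_distrib_left
        algebra_simps)
  then show ?thesis by (simp add: bilinear_conv_bounded_bilinear)
qed

lemmas matmul_simps =
  bounded_bilinear.add_left[OF bounded_bilinear_matrix_mult]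
  bounded_bilinear.add_right[OF bounded_bilinear_matrix_mult]
  bounded_bilinear.diff_left[OF bounded_bilinear_matrix_mult]
  bounded_bilinear.diff_right[OF bounded_bilinear_matrix_mult]
  bounded_bilinear.minus_left[OF bounded_bilinear_matrix_mult]
  bounded_bilinear.minus_right[OF bounded_bilinear_matrix_mult]
  bounded_bilinear.scaleR_left[OF bounded_bilinear_matrix_mult]
  bounded_bilinear.scaleR_right[OF bounded_bilinear_matrix_mult]
  bounded_bilinear.zero_left[OF bounded_bilinear_matrix_mult]
  bounded_bilinear.zero_right[OF bounded_bilinear_matrix_mult]

lemma transpose_linear [simp]:
  "transpose (A + B :: real^'n^'m) = transpose A + transpose B"
  "transpose (A - B :: real^'n^'m) = transpose A - transpose B"
  "transpose (- A :: real^'n^'m) = - transpose A"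
  "transpose (c *\<^sub>R (A :: real^'n^'m)) = c *\<^sub>R transpose A"
  "transpose (0 :: real^'n^'m) = 0"
  by (auto simp: transpose_def vec_eq_iff)

lemma bounded_linear_transpose: "bounded_linear (transpose :: real^'n^'m \<Rightarrow> real^'m^'n)"
  by (rule linear_conv_bounded_linear[THEN iffD1]) (simp add: linear_iff)

definition skew :: "real^'n^'n \<Rightarrow> bool"
  where "skew A \<longleftrightarrow> transpose A = - A"

lemma skew_iff: "skew A \<longleftrightarrow> (\<forall>i j. A $ j $ i = - (A $ i $ j))"
  unfolding skew_def vec_eq_iff transpose_def vec_lambda_beta uminus_vec_def ..

lemma skew_entry: "skew A \<Longrightarrow> A $ i $ j = - (A $ j $ i)"
  using skew_iff by blast

lemma skew_linear:
  "skew A \<Longrightarrow> skew B \<Longrightarrow> skew (A + B)"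
  "skew A \<Longrightarrow> skew B \<Longrightarrow> skew (A - B)"
  "skew A \<Longrightarrow> skew (c *\<^sub>R A)"
  "skew 0"
  by (auto simp: skew_def)

definition commutator :: "real^'n^'n \<Rightarrow> real^'n^'n \<Rightarrow> real^'n^'n"
  where "commutator A B = A ** B - B ** A"

lemma skew_commutator: "skew A \<Longrightarrow> skew B \<Longrightarrow> skew (commutator A B)"
  by (simp add: skew_def commutator_def matrix_transpose_mul matmul_simps)

definition conj_mat :: "real^'n^'n \<Rightarrow> real^'n^'n \<Rightarrow> real^'n^'n"
  where "conj_mat a X = a ** X ** transpose a"

lemma skew_conj_mat: "skew X \<Longrightarrow> skew (conj_mat a X)"
  by (simp add: skew_def conj_mat_def matrix_transpose_mul matmul_simps matrix_mul_assoc)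

lemma conj_mat_linear:
  "conj_mat a (X + Y) = conj_mat a X + conj_mat a Y"
  "conj_mat a (X - Y) = conj_mat a X - conj_mat a Y"
  "conj_mat a (c *\<^sub>R X) = c *\<^sub>R conj_mat a X"
  by (simp_all add: conj_mat_def matmul_simps)

lemma conj_mat_mult: "conj_mat (a ** b) X = conj_mat a (conj_mat b X)"
  by (simp add: conj_mat_def matrix_transpose_mul matrix_mul_assoc)

lemma conj_mat_one [simp]: "conj_mat (mat 1) X = X"
  by (simp add: conj_mat_def)

lemma orthogonal_conj_mat_mult:
  assumes "orthogonal_matrix a" shows "conj_mat a X ** conj_mat a Y = conj_mat a (X ** Y)"
proof -
  have "conj_mat a X ** conj_mat a Y = a ** X ** (transpose a ** a) ** Y ** transpose a"
    by (simp add: conj_mat_def matrix_mul_assoc)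
  also have "\<dots> = a ** X ** Y ** transpose a"
    using assms by (simp add: orthogonal_matrix_def)
  finally show ?thesis by (simp add: conj_mat_def matrix_mul_assoc)
qed

lemma orthogonal_conj_mat_commutator:
  "orthogonal_matrix a \<Longrightarrow>
    commutator (conj_mat a X) (conj_mat a Y) = conj_mat a (commutator X Y)"
  by (simp add: commutator_def orthogonal_conj_mat_mult conj_mat_linear)

lemma rotation_matrix_mul:
  "rotation_matrix a \<Longrightarrow> rotation_matrix b \<Longrightarrow> rotation_matrix (a ** b :: real^'n^'n)"
  by (simp add: rotation_matrix_def det_mul orthogonal_matrix_mul)

lemma SO5D:
  assumes "a \<in> SO5"
  shows "orthogonal_matrix a" "a ** transpose a = mat 1" "transpose a ** a = mat 1" "det a = 1"
  using assms by (auto simp: SO5_def rotation_matrix_def orthogonal_matrix_def)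

lemma SO5_mult: "a \<in> SO5 \<Longrightarrow> b \<in> SO5 \<Longrightarrow> a ** b \<in> SO5"
  by (simp add: SO5_def rotation_matrix_mul)

lemma SO5_transpose: "a \<in> SO5 \<Longrightarrow> transpose a \<in> SO5"
  by (simp add: SO5_def rotation_matrix_def orthogonal_matrix_transpose)

lemma SO5_one: "mat 1 \<in> SO5"
  by (simp add: SO5_def rotation_matrix_def orthogonal_matrix_id)

lemma SO5_cancel:
  assumes "a \<in> SO5"
  shows "a ** (transpose a ** x) = x" "transpose a ** (a ** x) = x"
  using SO5D[OF assms] by (simp_all add: matrix_mul_assoc)

section \<open>Rank-one matrices and one-parameter rotations\<close>

definition outer :: "real^'n \<Rightarrow> real^'n \<Rightarrow> real^'n^'n"
  where "outer u v = (\<chi> i j. u $ i * v $ j)"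

lemma outer_mult: "outer u v ** outer x y = (v \<bullet> x) *\<^sub>R outer u y"
  by (simp add: outer_def matrix_matrix_mult_def vec_eq_iff inner_vec_def sum_distrib_left
      sum_distrib_right mult_ac)

lemma outer_mult_vec: "outer u v *v x = (v \<bullet> x) *\<^sub>R u"
  by (simp add: outer_def matrix_vector_mult_def vec_eq_iff inner_vec_def sum_distrib_left
      sum_distrib_right mult_ac)

lemma transpose_outer [simp]: "transpose (outer u v) = outer v u"
  by (simp add: outer_def transpose_def vec_eq_iff mult.commute)

lemma outer_linear:
  "outer (u + u') v = outer u v + outer u' v" "outer u (v + v') = outer u v + outer u v'"
  "outer (u - u') v = outer u v - outer u' v" "outer u (v - v') = outer u v - outer u v'"
  "outer (c *\<^sub>R u) v = c *\<^sub>R outer u v" "outer u (c *\<^sub>R v) = c *\<^sub>R outer u v"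
  by (simp_all add: outer_def vec_eq_iff algebra_simps)

lemma bounded_bilinear_outer: "bounded_bilinear (outer :: real^'n \<Rightarrow> real^'n \<Rightarrow> real^'n^'n)"
  by (simp flip: bilinear_conv_bounded_bilinear add: bilinear_def linear_iff outer_linear)

lemma matrix_mult_outer: "a ** outer u v ** transpose b = outer (a *v u) (b *v v)"
proof -
  have "(\<Sum>k\<in>UNIV. (\<Sum>l\<in>UNIV. a$i$l * (u$l * v$k)) * b$j$k) =
     (\<Sum>l\<in>UNIV. a$i$l * u$l) * (\<Sum>k\<in>UNIV. b$j$k * v$k)" for i j
  proof -
    have "(\<Sum>l\<in>UNIV. a$i$l * (u$l * v$k)) * b$j$k = (\<Sum>l\<in>UNIV. a$i$l * u$l) * (b$j$k * v$k)" for k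
      unfolding sum_distrib_right by (rule sum.cong) simp_all
    then show ?thesis by (simp only: sum_distrib_left)
  qed
  then show ?thesis
    by (simp add: outer_def matrix_matrix_mult_def matrix_vector_mult_def vec_eq_iff transpose_def)
qed

text \<open>Along the path the determinant takes only the values 1 and -1, and a continuous function
  with finite range on a connected set is constant.\<close>

lemma det_of_orthogonal_path:
  fixes c :: "real \<Rightarrow> real^'n^'n"
  assumes "continuous_on UNIV c" "\<And>t. orthogonal_matrix (c t)" "det (c 0) = 1"
  shows "det (c t) = 1"
proof -
  have "continuous_on UNIV (\<lambda>t. det (c t))"
    unfolding det_def using assms(1) by (intro continuous_intros) auto
  moreover have "det (c t) \<in> {-1, 1}" for t
    using det_orthogonal_matrix[OF assms(2)] by auto
  then have "finite (range (\<lambda>t. det (c t)))"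
    by (intro finite_subset[OF image_subsetI, of UNIV _ "{-1, 1}"]) simp_all
  ultimately have "(\<lambda>t. det (c t)) constant_on UNIV"
    by (intro continuous_finite_range_constant connected_UNIV)
  then show ?thesis unfolding constant_on_def using assms(3) by (metis UNIV_I)
qed

text \<open>Rodrigues' formula: if \<open>K ** K ** K = - K\<close>, this is the exponential of
  \<open>t\<close> times \<open>K\<close>.\<close>

definition rot_path :: "real^'n^'n \<Rightarrow> real \<Rightarrow> real^'n^'n"
  where "rot_path K t = mat 1 + sin t *\<^sub>R K + (1 - cos t) *\<^sub>R (K ** K)"

lemma rot_path_orthogonal:
  assumes "skew K" "K ** K ** K = - K"
  shows "orthogonal_matrix (rot_path K t)"
proof -
  have tr: "transpose (rot_path K t) = mat 1 - sin t *\<^sub>R K + (1 - cos t) *\<^sub>R (K ** K)"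
    using assms(1) by (simp add: rot_path_def skew_def matrix_transpose_mul matmul_simps transpose_mat)
  have K4: "K ** (K ** K) = - K" "K ** (K ** (K ** K)) = - (K ** K)"
    using assms(2) by (simp_all add: matrix_mul_assoc matmul_simps)
  have z: "2 * (1 - cos t) - (1 - cos t) * (1 - cos t) - sin t * sin t = 0"
    using sin_cos_squared_add3[of t] by (simp add: algebra_simps)
  \<comment> \<open>With \<open>K ** K ** K = - K\<close> the odd terms cancel and the fourth power
    is \<open>- (K ** K)\<close>; for \<open>s = sin t\<close> and \<open>d = 1 - cos t\<close> the
    coefficient vanishes by \<open>z\<close>.\<close>
  have "(mat 1 - s *\<^sub>R K + d *\<^sub>R (K ** K)) ** (mat 1 + s *\<^sub>R K + d *\<^sub>R (K ** K)) =
      mat 1 + (2 * d - d * d - s * s) *\<^sub>R (K ** K)" for s d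
    by (simp add: matmul_simps matrix_mul_assoc[symmetric] K4) (simp add: vec_eq_iff algebra_simps)
  from this[of "sin t" "1 - cos t", unfolded z] show ?thesis
    unfolding orthogonal_matrix tr by (simp add: rot_path_def)
qed

lemma rot_path_0 [simp]: "rot_path K 0 = mat 1"
  by (simp add: rot_path_def)

lemma smooth_on_scaleR_const: "open S \<Longrightarrow> smooth_on S f \<Longrightarrow> smooth_on S (\<lambda>x. f x *\<^sub>R v)"
  by (intro smooth_on_bounded_linear_compose[OF _ bounded_linear_scaleR_left])

lemma smooth_rot_path: "smooth_on UNIV (rot_path K)"
proof -
  have "smooth_on UNIV (\<lambda>t. mat 1 + sin t *\<^sub>R K + (1 + (-1) * cos t) *\<^sub>R (K ** K))"
    by (intro smooth_on_add smooth_on_const smooth_on_scaleR_const smooth_on_sin_cos open_UNIV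
        smooth_on_bounded_linear_compose[OF _ bounded_linear_mult_right])
  then show ?thesis by (simp add: rot_path_def[abs_def])
qed

lemma rotation_rot_path:
  assumes "skew K" "K ** K ** K = - K"
  shows "rotation_matrix (rot_path K t)"
  unfolding rotation_matrix_def
  using rot_path_orthogonal[OF assms] det_of_orthogonal_path[of "rot_path K"]
    smooth_on_imp_continuous[OF smooth_rot_path[of K]] by simp

lemma rot_path_derivative: "(rot_path K has_vector_derivative K) (at 0)"
  unfolding rot_path_def[abs_def] by (auto intro!: derivative_eq_intros)

section \<open>The isotropy group as the stabilizer of a matrix\<close>

lemma sum_UNIV_Plus: "(\<Sum>i\<in>UNIV. f i) = (\<Sum>i\<in>UNIV. f (Inl i)) + (\<Sum>i\<in>UNIV. f (Inr i))"
  for f :: "'a::finite + 'b::finite \<Rightarrow> 'c::comm_monoid_add"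
  by (simp flip: UNIV_Plus_UNIV add: sum.Plus)

lemma all_32: "(\<forall>i. P i) \<longleftrightarrow> P (Inl 1) \<and> P (Inl 2) \<and> P (Inl 3) \<and> P (Inr 1) \<and> P (Inr 2)"
  for P :: "3 + 2 \<Rightarrow> bool"
  by (simp add: split_sum_all forall_3 forall_2)

lemma UNIV_32: "(UNIV :: (3 + 2) set) = {Inl 1, Inl 2, Inl 3, Inr 1, Inr 2}"
  using all_32[of "\<lambda>i. i \<in> {Inl 1, Inl 2, Inl 3, Inr 1, Inr 2}"] by auto

text \<open>The quarter turn from the fourth basis vector to the fifth. The isotropy group is its
  stabilizer under conjugation, which turns cosets into matrices.\<close>

definition J :: mat5
  where "J = outer (axis (Inr 2) 1) (axis (Inr 1) 1) - outer (axis (Inr 1) 1) (axis (Inr 2) 1)"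

lemma J_entry: "J $ i $ j = (if i = Inr 2 \<and> j = Inr 1 then 1 else if i = Inr 1 \<and> j = Inr 2 then -1 else 0)"
  by (auto simp: J_def outer_def axis_def)

lemma skew_J: "skew J"
  by (auto simp: skew_iff J_entry)

text \<open>Direct expansion of the Leibniz formula: the permutations of the five indices are
  unfolded by splitting off one index at a time, leaving a polynomial identity.\<close>

lemma det_block_diag: "det (block_diag b c) = det b * det c"
proof -
  have f: "finite {Inl 2 :: 3+2, Inl 3, Inr 1, Inr 2}" "Inl 1 \<notin> {Inl 2 :: 3+2, Inl 3, Inr 1, Inr 2}"
    "finite {Inl 3 :: 3+2, Inr 1, Inr 2}" "Inl 2 \<notin> {Inl 3 :: 3+2, Inr 1, Inr 2}"
    "finite {Inr 1 :: 3+2, Inr 2}" "Inl 3 \<notin> {Inr 1 :: 3+2, Inr 2}"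
    "finite {Inr 2 :: 3+2}" "Inr 1 \<notin> {Inr 2 :: 3+2}"
    by auto
  show ?thesis
    unfolding det_def[of "block_diag b c"] UNIV_32
    unfolding sum_over_permutations_insert[OF f(1,2)]
    unfolding sum_over_permutations_insert[OF f(3,4)]
    unfolding sum_over_permutations_insert[OF f(5,6)]
    unfolding sum_over_permutations_insert[OF f(7,8)]
    unfolding permutes_sing
    apply (simp add: block_diag_def sign_swap_id permutation_swap_id permutation_compose sign_compose
       sign_id swap_id_eq det_3 det_2)
    apply (simp add: algebra_simps)
    done
qed

lemma block_diag_entry [simp]:
  "block_diag b c $ Inl k $ Inl l = b $ k $ l" "block_diag b c $ Inr m $ Inr n = c $ m $ n"
  "block_diag b c $ Inl k $ Inr n = 0" "block_diag b c $ Inr m $ Inl l = 0"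
  by (simp_all add: block_diag_def)

lemma matrix_eqI_32:
  fixes A B :: mat5
  assumes "\<And>k l. A $ Inl k $ Inl l = B $ Inl k $ Inl l" "\<And>k n. A $ Inl k $ Inr n = B $ Inl k $ Inr n"
    "\<And>m l. A $ Inr m $ Inl l = B $ Inr m $ Inl l" "\<And>m n. A $ Inr m $ Inr n = B $ Inr m $ Inr n"
  shows "A = B"
  by (simp add: vec_eq_iff split_sum_all assms)

lemma mat_entry: "(mat 1 :: real^'n^'n) $ i $ j = (if i = j then 1 else 0)"
  by (simp add: mat_def)

lemma matmul_entry: "((A :: mat5) ** B) $ i $ j =
    (\<Sum>k\<in>UNIV. A $ i $ Inl k * B $ Inl k $ j) + (\<Sum>k\<in>UNIV. A $ i $ Inr k * B $ Inr k $ j)"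
  by (simp add: matrix_matrix_mult_def sum_UNIV_Plus)

lemma transpose_entry: "transpose A $ i $ j = A $ j $ i"
  by (simp add: transpose_def)

lemma block_diag_mult: "block_diag b c ** block_diag b' c' = block_diag (b ** b') (c ** c')"
  by (rule matrix_eqI_32) (simp_all add: matmul_entry, simp_all add: matrix_matrix_mult_def)

lemma transpose_block_diag: "transpose (block_diag b c) = block_diag (transpose b) (transpose c)"
  by (rule matrix_eqI_32) (simp_all add: transpose_entry)

lemma block_diag_one: "block_diag (mat 1) (mat 1) = mat 1"
  by (rule matrix_eqI_32) (simp_all add: mat_entry)

lemma block_diag_inject: "block_diag b c = block_diag b' c' \<longleftrightarrow> b = b' \<and> c = c'"
  by (auto simp: vec_eq_iff split_sum_all)

lemma block_diag_orthogonal: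
  "orthogonal_matrix (block_diag b c) \<longleftrightarrow> orthogonal_matrix b \<and> orthogonal_matrix c"
  by (auto simp: orthogonal_matrix_def transpose_block_diag block_diag_mult block_diag_inject
      simp flip: block_diag_one)

text \<open>In the off-diagonal positions an invertible block of \<open>J\<close> meets a zero block
  and forces the entries to vanish; the lower block must commute with a quarter turn, which gives it
  the shape of a complex number.\<close>

lemma commutes_J_iff:
  "h ** J = J ** h \<longleftrightarrow>
    (\<forall>k n. h $ Inl k $ Inr n = 0) \<and> (\<forall>k n. h $ Inr n $ Inl k = 0) \<and>
    h $ Inr 1 $ Inr 1 = h $ Inr 2 $ Inr 2 \<and> h $ Inr 1 $ Inr 2 = - h $ Inr 2 $ Inr 1"
proof -
  have "h ** J = J ** h \<longleftrightarrow> (\<forall>i j. (h ** J) $ i $ j = (J ** h) $ i $ j)"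
    by (simp add: vec_eq_iff)
  then show ?thesis
    by (auto simp: matmul_entry J_entry sum_2 sum_3 split_sum_all forall_2 forall_3)
qed

lemma rotation_2_commutes:
  fixes c :: "real^2^2"
  assumes "rotation_matrix c"
  shows "c $ 1 $ 1 = c $ 2 $ 2" "c $ 1 $ 2 = - c $ 2 $ 1"
proof -
  let ?a = "c $ 1 $ 1" and ?b = "c $ 1 $ 2" and ?d = "c $ 2 $ 1" and ?e = "c $ 2 $ 2"
  have "transpose c ** c = mat 1" "det c = 1"
    using assms by (auto simp: rotation_matrix_def orthogonal_matrix_def)
  then have e: "?a * ?a + ?d * ?d = 1" "?b * ?b + ?e * ?e = 1" "?a * ?e - ?b * ?d = 1"
    by (simp_all add: vec_eq_iff matrix_matrix_mult_def sum_2 forall_2 transpose_def mat_def det_2)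
  \<comment> \<open>The squares sum to 2 because both columns are unit vectors, and the cross terms
    are -2 times the determinant.\<close>
  have "(?a - ?e)\<^sup>2 + (?b + ?d)\<^sup>2 = 0"
    using e by (simp add: power2_eq_square algebra_simps)
  then show "?a = ?e" "?b = - ?d" by (auto simp: sum_power2_eq_zero_iff)
qed

lemma SO3xSO2_iff: "h \<in> SO3xSO2 \<longleftrightarrow> h \<in> SO5 \<and> h ** J = J ** h"
proof
  assume "h \<in> SO3xSO2"
  then obtain b c where h: "h = block_diag b c" "rotation_matrix b" "rotation_matrix c"
    unfolding SO3xSO2_def by blast
  then show "h \<in> SO5 \<and> h ** J = J ** h"
    using rotation_2_commutes[OF h(3)]
    by (simp add: SO5_def rotation_matrix_def block_diag_orthogonal det_block_diag commutes_J_iff)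
next
  assume h: "h \<in> SO5 \<and> h ** J = J ** h"
  define b :: "real^3^3" where "b = (\<chi> k l. h $ Inl k $ Inl l)"
  define c :: "real^2^2" where "c = (\<chi> k l. h $ Inr k $ Inr l)"
  have hb: "h = block_diag b c"
    using h by (intro matrix_eqI_32) (simp_all add: b_def c_def commutes_J_iff)
  have o: "orthogonal_matrix b" "orthogonal_matrix c" and d: "det b * det c = 1"
    using h by (simp_all add: SO5_def rotation_matrix_def hb block_diag_orthogonal det_block_diag)
  \<comment> \<open>Excludes \<open>det b = det c = -1\<close>: for a block of the shape of a
    complex number the determinant is a sum of squares.\<close>
  have "det c = (h $ Inr 2 $ Inr 2)\<^sup>2 + (h $ Inr 2 $ Inr 1)\<^sup>2"
    using h by (simp add: commutes_J_iff det_2 c_def power2_eq_square)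
  then have "det c = 1" using det_orthogonal_matrix[OF o(2)]
    by (smt (verit) zero_le_power2)
  then show "h \<in> SO3xSO2"
    unfolding SO3xSO2_def rotation_matrix_def using o d hb by auto
qed

lemma SO3xSO2_SO5: "h \<in> SO3xSO2 \<Longrightarrow> h \<in> SO5"
  by (simp add: SO3xSO2_iff)

lemma SO3xSO2_mult: "h \<in> SO3xSO2 \<Longrightarrow> k \<in> SO3xSO2 \<Longrightarrow> h ** k \<in> SO3xSO2"
  by (simp add: SO3xSO2_iff SO5_mult) (metis matrix_mul_assoc)

lemma conj_mat_eq_iff:
  assumes "a \<in> SO5" "b \<in> SO5"
  shows "conj_mat a X = conj_mat b X \<longleftrightarrow> (transpose b ** a) ** X = X ** (transpose b ** a)"
proof
  assume "conj_mat a X = conj_mat b X"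
  then have "transpose b ** (conj_mat a X) ** a = transpose b ** (conj_mat b X) ** a" by simp
  then show "(transpose b ** a) ** X = X ** (transpose b ** a)"
    using SO5D[OF assms(1)]
    by (simp add: conj_mat_def SO5_cancel[OF assms(2)] flip: matrix_mul_assoc)
next
  assume "(transpose b ** a) ** X = X ** (transpose b ** a)"
  then have "b ** ((transpose b ** a) ** X) ** transpose a = b ** (X ** (transpose b ** a)) ** transpose a"
    by simp
  then show "conj_mat a X = conj_mat b X"
    using SO5D[OF assms(1)]
    by (simp add: conj_mat_def SO5_cancel[OF assms(2)] flip: matrix_mul_assoc)
qed

lemma mem_coset: "x \<in> coset a \<longleftrightarrow> (\<exists>h\<in>SO3xSO2. x = a ** h)"
  by (auto simp: coset_def)

lemma coset_mult_right: "h \<in> SO3xSO2 \<Longrightarrow> coset (a ** h) \<subseteq> coset a"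
  unfolding subset_iff mem_coset using SO3xSO2_mult by (metis matrix_mul_assoc)

text \<open>Orbit and stabilizer: by \<open>SO3xSO2_iff\<close>, \<open>transpose b ** a\<close>
  lies in the isotropy group exactly when it commutes with \<open>J\<close>.\<close>

lemma coset_eq_iff:
  assumes "a \<in> SO5" "b \<in> SO5"
  shows "coset a = coset b \<longleftrightarrow> conj_mat a J = conj_mat b J"
proof
  assume "coset a = coset b"
  moreover have "a \<in> coset a"
    unfolding mem_coset by (intro bexI[of _ "mat 1"]) (simp_all add: SO3xSO2_iff SO5_one)
  ultimately obtain h where h: "h \<in> SO3xSO2" "a = b ** h" by (auto simp: mem_coset)
  then have "transpose b ** a = h" using SO5_cancel[OF assms(2)] by simp
  then show "conj_mat a J = conj_mat b J"
    using h conj_mat_eq_iff[OF assms] by (simp add: SO3xSO2_iff)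
next
  have sub: "coset a \<subseteq> coset b" if "conj_mat a J = conj_mat b J" "a \<in> SO5" "b \<in> SO5" for a b
  proof -
    have "transpose b ** a \<in> SO3xSO2"
      using that conj_mat_eq_iff[OF that(2,3)] by (simp add: SO3xSO2_iff SO5_mult SO5_transpose)
    from coset_mult_right[OF this, of b] show ?thesis by (simp add: SO5_cancel that)
  qed
  assume "conj_mat a J = conj_mat b J"
  then show "coset a = coset b" using sub assms by (metis subset_antisym)
qed

lemma act_coset: "act b (coset a) = coset (b ** a)"
  by (auto simp: act_def coset_def image_image matrix_mul_assoc)

lemma act_act: "act a (act b q) = act (a ** b) q"
  by (simp add: act_def image_image matrix_mul_assoc)

lemma act_one: "act (mat 1) q = q"
  by (simp add: act_def)

lemma coset_in_M: "a \<in> SO5 \<Longrightarrow> coset a \<in> M"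
  by (simp add: M_def)

lemma act_in_M: "a \<in> SO5 \<Longrightarrow> q \<in> M \<Longrightarrow> act a q \<in> M"
  by (auto simp: M_def act_coset SO5_mult)

section \<open>Velocities of curves of matrices\<close>

text \<open>For a matrix group this plays the role of the Lie algebra. The curves run over the whole
  real line, so that products and rescalings stay admissible without shrinking intervals.\<close>

definition velocities :: "mat5 set \<Rightarrow> mat5 set"
  where "velocities S = {X. \<exists>c. smooth_on UNIV c \<and> (\<forall>t. c t \<in> S) \<and> c 0 = mat 1 \<and>
    (c has_vector_derivative X) (at 0)}"

lemma velocities_add:
  assumes S: "\<And>a b. a \<in> S \<Longrightarrow> b \<in> S \<Longrightarrow> a ** b \<in> S"
    and "X \<in> velocities S" "Y \<in> velocities S"
  shows "X + Y \<in> velocities S"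
proof -
  obtain c d where
    c: "smooth_on UNIV c" "\<And>t. c t \<in> S" "c 0 = mat 1" "(c has_vector_derivative X) (at 0)" and
    d: "smooth_on UNIV d" "\<And>t. d t \<in> S" "d 0 = mat 1" "(d has_vector_derivative Y) (at 0)"
    using assms(2,3) unfolding velocities_def by blast
  have "((\<lambda>t. c t ** d t) has_vector_derivative c 0 ** Y + X ** d 0) (at 0)"
    by (rule bounded_bilinear.has_vector_derivative[OF bounded_bilinear_matrix_mult c(4) d(4)])
  moreover have "smooth_on UNIV (\<lambda>t. c t ** d t)"
    by (intro smooth_on_bilinear[OF _ bounded_bilinear_matrix_mult] c(1) d(1) open_UNIV)
  ultimately show ?thesis
    unfolding velocities_def mem_Collect_eq
    by (intro exI[of _ "\<lambda>t. c t ** d t"]) (auto simp: c d S add.commute)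
qed

lemma velocities_scaleR:
  assumes "X \<in> velocities S" shows "r *\<^sub>R X \<in> velocities S"
proof -
  obtain c where
    c: "smooth_on UNIV c" "\<And>t. c t \<in> S" "c 0 = mat 1" "(c has_vector_derivative X) (at 0)"
    using assms unfolding velocities_def by blast
  have "((\<lambda>t. r * t) has_vector_derivative r) (at 0)"
    by (auto intro!: derivative_eq_intros)
  then have "(c \<circ> (\<lambda>t. r * t) has_vector_derivative r *\<^sub>R X) (at 0)"
    by (rule vector_diff_chain_at) (simp add: c)
  moreover have "smooth_on UNIV (\<lambda>t. c (r * t))"
    by (rule smooth_on_compose[OF open_UNIV _ smooth_on_bounded_linear[OF bounded_linear_mult_right] c(1)])
       simp
  ultimately show ?thesis
    unfolding velocities_def mem_Collect_eq
    by (intro exI[of _ "\<lambda>t. c (r * t)"]) (auto simp: c o_def)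
qed

lemma velocities_sum:
  assumes "\<And>a b. a \<in> S \<Longrightarrow> b \<in> S \<Longrightarrow> a ** b \<in> S" "finite I" "I \<noteq> {}"
    and "\<And>i. i \<in> I \<Longrightarrow> X i \<in> velocities S"
  shows "(\<Sum>i\<in>I. X i) \<in> velocities S"
  using assms(2-4) by (induction I rule: finite_ne_induct) (auto intro: velocities_add[OF assms(1)])

text \<open>The standard spanning set of the skew matrices, each satisfying the cubic identity
  behind \<open>rot_path\<close>; \<open>elem i i\<close> is 0.\<close>

definition elem :: "'n \<Rightarrow> 'n \<Rightarrow> real^'n^'n"
  where "elem i j = outer (axis i 1) (axis j 1) - outer (axis j 1) (axis i 1)"

lemma skew_elem: "skew (elem i j)"
  by (simp add: skew_def elem_def)

lemma elem_cube: "elem i j ** elem i j ** elem i j = - elem i j"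
proof (cases "i = j")
  case True then show ?thesis by (simp add: elem_def matmul_simps)
next
  case False then show ?thesis
    by (simp add: elem_def matmul_simps outer_mult inner_axis_axis)
qed

text \<open>Each unordered pair of indices occurs twice with equal contributions, whence the factor
  1/2.\<close>

lemma skew_eq_sum_elem:
  assumes "skew X" shows "X = (\<Sum>i\<in>UNIV. \<Sum>j\<in>UNIV. (X $ i $ j / 2) *\<^sub>R elem i j)"
proof -
  have "(\<Sum>i\<in>UNIV. \<Sum>j\<in>UNIV. (X $ i $ j / 2) *\<^sub>R elem i j) $ k $ l = X $ k $ l" for k l
  proof -
    have "(\<Sum>i\<in>UNIV. \<Sum>j\<in>UNIV. (X $ i $ j / 2) *\<^sub>R elem i j) $ k $ l =
      (\<Sum>i\<in>UNIV. \<Sum>j\<in>UNIV. (if i = k then (if j = l then X $ i $ j / 2 else 0) else 0)) -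
      (\<Sum>i\<in>UNIV. \<Sum>j\<in>UNIV. (if j = k then (if i = l then X $ i $ j / 2 else 0) else 0))"
      unfolding sum_subtractf[symmetric] sum_component
      by (intro sum.cong refl) (auto simp: elem_def outer_def axis_def)
    also have "(\<Sum>i\<in>UNIV. \<Sum>j\<in>UNIV. (if i = k then (if j = l then X $ i $ j / 2 else 0) else 0)) = X $ k $ l / 2"
      by (subst sum.swap) simp
    also have "(\<Sum>i\<in>UNIV. \<Sum>j\<in>UNIV. (if j = k then (if i = l then X $ i $ j / 2 else 0) else 0)) = X $ l $ k / 2"
      by simp
    finally show ?thesis using skew_entry[OF assms, of l k] by simp
  qed
  then show ?thesis by (simp add: vec_eq_iff)
qed

lemma elem_velocities_SO5: "elem i j \<in> velocities SO5"
  unfolding velocities_def SO5_def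
  using smooth_rot_path rotation_rot_path[OF skew_elem elem_cube] rot_path_derivative rot_path_0
  by blast

lemma velocities_SO5: "skew X \<Longrightarrow> X \<in> velocities SO5"
  by (subst skew_eq_sum_elem)
     (auto intro!: velocities_sum velocities_scaleR SO5_mult elem_velocities_SO5)

text \<open>On skew matrices this cuts out the Lie algebra of the isotropy group, and
  \<open>off_diagonal\<close> its complement in the Cartan decomposition.\<close>

definition block_diagonal :: "mat5 \<Rightarrow> bool"
  where "block_diagonal Z \<longleftrightarrow> (\<forall>k n. Z $ Inl k $ Inr n = 0 \<and> Z $ Inr n $ Inl k = 0)"

definition off_diagonal :: "mat5 \<Rightarrow> bool"
  where "off_diagonal X \<longleftrightarrow> (\<forall>k l. X $ Inl k $ Inl l = 0) \<and> (\<forall>m n. X $ Inr m $ Inr n = 0)"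

lemma elem_velocities_SO3xSO2:
  assumes "elem i j ** J = J ** elem i j" shows "elem i j \<in> velocities SO3xSO2"
proof -
  have "rot_path (elem i j) t ** J = J ** rot_path (elem i j) t" for t
  proof -
    have "elem i j ** elem i j ** J = J ** (elem i j ** elem i j)"
      by (simp add: assms flip: matrix_mul_assoc) (simp add: assms matrix_mul_assoc)
    then show ?thesis by (simp add: rot_path_def matmul_simps assms)
  qed
  then have "rot_path (elem i j) t \<in> SO3xSO2" for t
    using rotation_rot_path[OF skew_elem elem_cube] by (simp add: SO3xSO2_iff SO5_def)
  then show ?thesis
    unfolding velocities_def using smooth_rot_path rot_path_derivative rot_path_0 by blast
qed

lemma zero_velocities: "mat 1 \<in> S \<Longrightarrow> 0 \<in> velocities S"
  unfolding velocities_def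
  by (auto intro!: exI[of _ "\<lambda>t. mat 1"] smooth_on_const)

text \<open>Only entries in the diagonal blocks contribute; the corresponding
  \<open>elem i j\<close> commute with \<open>J\<close>, so their rotations stay in the isotropy
  group.\<close>

lemma velocities_SO3xSO2:
  assumes "skew Z" "block_diagonal Z" shows "Z \<in> velocities SO3xSO2"
proof -
  have "(Z $ i $ j / 2) *\<^sub>R elem i j \<in> velocities SO3xSO2" for i j
  proof (cases "Z $ i $ j = 0")
    case True then show ?thesis
      by (auto intro!: zero_velocities simp: SO3xSO2_iff SO5_one)
  next
    case False
    then consider k l where "i = Inl k" "j = Inl l" | m n where "i = Inr m" "j = Inr n"
      using assms(2) unfolding block_diagonal_def by (metis sum.exhaust)
    then have "elem i j ** J = J ** elem i j"
    proof cases
      case 1 then show ?thesis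
        by (simp add: elem_def J_def matmul_simps outer_mult inner_axis_axis)
    next
      \<comment> \<open>Here \<open>elem i j\<close> is 0, \<open>J\<close> or
        \<open>- J\<close>.\<close>
      case 2
      have "(m = 1 \<or> m = 2) \<and> (n = 1 \<or> n = 2)" using exhaust_2 by auto
      then show ?thesis using 2
        by (auto simp: elem_def J_def matmul_simps outer_mult inner_axis_axis)
    qed
    then show ?thesis by (intro velocities_scaleR elem_velocities_SO3xSO2)
  qed
  then show ?thesis
    by (subst skew_eq_sum_elem[OF assms(1)])
       (auto intro!: velocities_sum SO3xSO2_mult)
qed

text \<open>The algebraic core of symmetry: brackets within the complement fall into the isotropy
  algebra. Vanishing torsion, metric compatibility and parallelism all rest on it.\<close>

lemma off_diagonal_commutator:
  assumes "off_diagonal X" "off_diagonal Y" shows "block_diagonal (commutator X Y)"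
  using assms by (simp add: off_diagonal_def block_diagonal_def commutator_def matmul_entry)

text \<open>The double commutator is -(ad J)^2 applied to \<open>Y\<close>, the projection of a skew
  matrix onto its off-diagonal part.\<close>

lemma off_diagonal_part:
  assumes "skew Y"
  shows "off_diagonal (commutator J (commutator Y J))"
    and "block_diagonal (Y - commutator J (commutator Y J))"
proof -
  have "Y $ Inr 1 $ Inr 1 = 0" "Y $ Inr 2 $ Inr 2 = 0" "Y $ Inr 2 $ Inr 1 = - (Y $ Inr 1 $ Inr 2)"
    using skew_entry[OF assms, of "Inr 1" "Inr 1"] skew_entry[OF assms, of "Inr 2" "Inr 2"]
      skew_entry[OF assms, of "Inr 2" "Inr 1"] by simp_all
  then show "off_diagonal (commutator J (commutator Y J))"
    by (simp add: off_diagonal_def commutator_def matmul_entry J_entry sum_2 forall_2)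
  show "block_diagonal (Y - commutator J (commutator Y J))"
    by (simp add: block_diagonal_def commutator_def matmul_entry J_entry sum_2 forall_2)
qed

section \<open>Smooth functions and fundamental vector fields\<close>

text \<open>Off the group \<open>F\<close> is arbitrary, so only its derivatives tangent to
  \<open>SO5\<close> carry information about \<open>f\<close>.\<close>

definition local_lift :: "(point \<Rightarrow> real) \<Rightarrow> mat5 set \<Rightarrow> (mat5 \<Rightarrow> real) \<Rightarrow> bool"
  where "local_lift f U F \<longleftrightarrow> open U \<and> smooth_on U F \<and> (\<forall>x\<in>U \<inter> SO5. F x = f (coset x))"

lemma smooth_fun_iff: "smooth_fun f \<longleftrightarrow> (\<forall>a\<in>SO5. \<exists>U F. a \<in> U \<and> local_lift f U F)"
  unfolding smooth_fun_def smooth_on_SO5_def local_lift_def by meson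

lemma smooth_funE:
  assumes "smooth_fun f" "a \<in> SO5"
  obtains U F where "a \<in> U" "local_lift f U F"
  using assms smooth_fun_iff by blast

lemma smooth_fun_cong:
  assumes "\<And>p. p \<in> M \<Longrightarrow> f p = g p" shows "smooth_fun f \<longleftrightarrow> smooth_fun g"
  unfolding smooth_fun_iff local_lift_def using assms coset_in_M by (metis IntD2)

lemma smooth_fun_comb:
  assumes "smooth_fun f" "smooth_fun g"
    and "\<And>U (F :: mat5 \<Rightarrow> real) G. open U \<Longrightarrow> smooth_on U F \<Longrightarrow> smooth_on U G \<Longrightarrow> smooth_on U (\<lambda>x. p (F x) (G x))"
  shows "smooth_fun (\<lambda>q. p (f q) (g q))"
  unfolding smooth_fun_iff
proof
  fix a assume a: "a \<in> SO5"
  obtain U F where F: "a \<in> U" "local_lift f U F" using smooth_funE[OF assms(1) a] .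
  obtain V G where G: "a \<in> V" "local_lift g V G" using smooth_funE[OF assms(2) a] .
  have "smooth_on (U \<inter> V) F" "smooth_on (U \<inter> V) G" "open (U \<inter> V)"
    using F G unfolding local_lift_def by (auto intro: smooth_on_subset)
  then have "local_lift (\<lambda>q. p (f q) (g q)) (U \<inter> V) (\<lambda>x. p (F x) (G x))"
    using F G assms(3) unfolding local_lift_def by auto
  then show "\<exists>U F. a \<in> U \<and> local_lift (\<lambda>q. p (f q) (g q)) U F" using F G by blast
qed

lemma smooth_fun_const: "smooth_fun (\<lambda>q. c)"
  unfolding smooth_fun_iff local_lift_def by (auto intro!: exI[of _ UNIV] smooth_on_const)

lemma smooth_fun_add: "smooth_fun f \<Longrightarrow> smooth_fun g \<Longrightarrow> smooth_fun (\<lambda>q. f q + g q)"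
  by (rule smooth_fun_comb) (auto intro: smooth_on_add)

lemma smooth_fun_mult: "smooth_fun f \<Longrightarrow> smooth_fun g \<Longrightarrow> smooth_fun (\<lambda>q. f q * g q)"
  by (rule smooth_fun_comb) (auto intro: smooth_on_bilinear[OF _ bounded_bilinear_mult])

lemma smooth_fun_diff: "smooth_fun f \<Longrightarrow> smooth_fun g \<Longrightarrow> smooth_fun (\<lambda>q. f q - g q)"
  using smooth_fun_add[OF _ smooth_fun_mult[OF smooth_fun_const[of "-1"]]] by simp

lemma smooth_fun_sum:
  "finite I \<Longrightarrow> (\<And>i. i \<in> I \<Longrightarrow> smooth_fun (f i)) \<Longrightarrow> smooth_fun (\<lambda>q. \<Sum>i\<in>I. f i q)"
  by (induction I rule: finite_induct) (auto intro: smooth_fun_const smooth_fun_add)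

lemma smooth_fun_lift:
  assumes "smooth_on UNIV F" "\<And>a. a \<in> SO5 \<Longrightarrow> f (coset a) = F a"
  shows "smooth_fun f"
  unfolding smooth_fun_iff local_lift_def using assms by (auto intro!: exI[of _ UNIV])

lemma bounded_linear_matmul_left: "bounded_linear (\<lambda>x :: real^'n^'m. a ** x)"
  and bounded_linear_matmul_right: "bounded_linear (\<lambda>x :: real^'n^'m. x ** b)"
  by (rule bounded_bilinear.bounded_linear_right[OF bounded_bilinear_matrix_mult],
      rule bounded_bilinear.bounded_linear_left[OF bounded_bilinear_matrix_mult])

lemma smooth_fun_act:
  assumes "b \<in> SO5" "smooth_fun f" shows "smooth_fun (\<lambda>q. f (act b q))"
  unfolding smooth_fun_iff
proof
  fix a assume a: "a \<in> SO5"
  obtain U F where F: "b ** a \<in> U" "local_lift f U F"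
    using smooth_funE[OF assms(2) SO5_mult[OF assms(1) a]] .
  let ?V = "(\<lambda>x. b ** x) -` U"
  have o: "open ?V"
    using F(2) unfolding local_lift_def
    by (intro open_vimage linear_continuous_on bounded_linear_matmul_left) auto
  have "local_lift (\<lambda>q. f (act b q)) ?V (\<lambda>x. F (b ** x))"
    using F(2) o assms(1) unfolding local_lift_def
    by (auto simp: act_coset SO5_mult
        intro!: smooth_on_compose[OF _ _ smooth_on_bounded_linear[OF bounded_linear_matmul_left]])
  then show "\<exists>U F. a \<in> U \<and> local_lift (\<lambda>q. f (act b q)) U F" using F(1) by auto
qed

lemma smooth_fun_act_iff:
  assumes "b \<in> SO5" shows "smooth_fun (\<lambda>q. f (act b q)) \<longleftrightarrow> smooth_fun f"
proof
  assume "smooth_fun (\<lambda>q. f (act b q))"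
  from smooth_fun_act[OF SO5_transpose[OF assms] this] show "smooth_fun f"
    by (simp add: act_act SO5D[OF assms] act_one)
qed (rule smooth_fun_act[OF assms])

section \<open>Differentiation along curves in the group\<close>

lemma smooth_on_path:
  fixes d :: "real \<Rightarrow> mat5"
  assumes "open S" "smooth_on S d" "\<And>t. t \<in> S \<Longrightarrow> d t \<in> SO5" "smooth_fun f"
  shows "smooth_on S (\<lambda>t. f (coset (d t)))"
proof (rule smooth_on_local)
  fix t assume t: "t \<in> S"
  obtain U F where F: "d t \<in> U" "local_lift f U F" using smooth_funE[OF assms(4) assms(3)[OF t]] .
  have o: "open (S \<inter> d -` U)"
    using F(2) unfolding local_lift_def
    by (intro continuous_open_preimage smooth_on_imp_continuous assms) auto
  have "smooth_on (S \<inter> d -` U) (\<lambda>t. F (d t))"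
    using F(2) unfolding local_lift_def
    by (intro smooth_on_compose[OF o _ smooth_on_subset[OF assms(2)]]) auto
  then have "smooth_on (S \<inter> d -` U) (\<lambda>t. f (coset (d t)))"
    using F(2) assms(3) unfolding local_lift_def by (subst smooth_on_cong[OF o]) auto
  with o t F show "\<exists>U. open U \<and> t \<in> U \<and> smooth_on U (\<lambda>t. f (coset (d t)))" by blast
qed

text \<open>Along a curve in \<open>SO5\<close> the extension and the function agree, so any
  extension yields the derivative.\<close>

lemma path_derivative:
  assumes F: "local_lift f U F" "d t0 \<in> U"
    and d: "(d has_vector_derivative V) (at t0)" "eventually (\<lambda>t. d t \<in> SO5) (nhds t0)"
  shows "((\<lambda>t. f (coset (d t))) has_real_derivative frechet_derivative F (at (d t0)) V) (at t0)"
proof -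
  have dF: "F differentiable (at (d t0))"
    using F unfolding local_lift_def by (auto intro: smooth_on_differentiable)
  have "((\<lambda>t. F (d t)) has_derivative (\<lambda>r. frechet_derivative F (at (d t0)) (r *\<^sub>R V))) (at t0)"
    using d(1) unfolding has_vector_derivative_def
    by (rule has_derivative_compose) (rule has_derivative_frechet[OF dF])
  then have D: "((\<lambda>t. F (d t)) has_real_derivative frechet_derivative F (at (d t0)) V) (at t0)"
    using linear_cmul[OF linear_frechet_derivative[OF dF]]
    by (simp add: has_field_derivative_def mult_commute_abs)
  have "(d \<longlongrightarrow> d t0) (at t0)"
    using has_vector_derivative_continuous[OF d(1)] unfolding continuous_at .
  from topological_tendstoD[OF this _ F(2)] have "eventually (\<lambda>t. d t \<in> U) (at t0)"
    using F(1) by (simp add: local_lift_def)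
  then have "eventually (\<lambda>t. d t \<in> U) (nhds t0)"
    using F(2) by (simp add: eventually_nhds_conv_at)
  with d(2) have "eventually (\<lambda>t. F (d t) = f (coset (d t))) (nhds t0)"
    by eventually_elim (use F in \<open>auto simp: local_lift_def\<close>)
  from DERIV_cong_ev[OF refl this refl] D show ?thesis by blast
qed

definition rep :: "point \<Rightarrow> mat5"
  where "rep q = (SOME a. a \<in> SO5 \<and> coset a = q)"

lemma rep:
  assumes "q \<in> M" shows "rep q \<in> SO5" "coset (rep q) = q"
proof -
  have "\<exists>a. a \<in> SO5 \<and> coset a = q" using assms unfolding M_def by blast
  from someI_ex[OF this] show "rep q \<in> SO5" "coset (rep q) = q"
    unfolding rep_def by auto
qed

text \<open>The derivative of some chosen extension. A linear map on all matrices makes linearity in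
  the direction immediate; on velocities of curves in the group the choice does not show.\<close>

definition lift_deriv :: "(point \<Rightarrow> real) \<Rightarrow> mat5 \<Rightarrow> mat5 \<Rightarrow> real"
  where "lift_deriv f a = frechet_derivative (SOME F. \<exists>U. a \<in> U \<and> local_lift f U F) (at a)"

lemma lift_deriv_lift:
  assumes "smooth_fun f" "a \<in> SO5"
  obtains U F where "a \<in> U" "local_lift f U F" "lift_deriv f a = frechet_derivative F (at a)"
proof -
  have "\<exists>F. \<exists>U. a \<in> U \<and> local_lift f U F" using smooth_funE[OF assms] by metis
  from someI_ex[OF this] that show thesis unfolding lift_deriv_def by blast
qed

lemma linear_lift_deriv:
  assumes "smooth_fun f" "a \<in> SO5" shows "linear (lift_deriv f a)"
proof -
  obtain U F where F: "a \<in> U" "local_lift f U F" "lift_deriv f a = frechet_derivative F (at a)"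
    using lift_deriv_lift[OF assms] .
  then show ?thesis
    by (auto simp: local_lift_def intro!: linear_frechet_derivative smooth_on_differentiable)
qed

lemma path_lift_deriv:
  assumes "smooth_fun f" "d t0 \<in> SO5"
    and "(d has_vector_derivative V) (at t0)" "eventually (\<lambda>t. d t \<in> SO5) (nhds t0)"
  shows "((\<lambda>t. f (coset (d t))) has_real_derivative lift_deriv f (d t0) V) (at t0)"
proof -
  obtain U F where F: "d t0 \<in> U" "local_lift f U F"
    "lift_deriv f (d t0) = frechet_derivative F (at (d t0))"
    using lift_deriv_lift[OF assms(1,2)] .
  then show ?thesis using path_derivative[OF F(2,1) assms(3,4)] by simp
qed

text \<open>Independent of the representative only for skew \<open>X\<close>.\<close>

definition fund :: "mat5 \<Rightarrow> point \<Rightarrow> tvector"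
  where "fund X q = (\<lambda>f. if smooth_fun f then lift_deriv f (rep q) (X ** rep q) else 0)"

lemma fund_linear:
  assumes "q \<in> M"
  shows "fund (X + Y) q = fund X q + fund Y q" "fund (X - Y) q = fund X q - fund Y q"
    "fund (c *\<^sub>R X) q = c *\<^sub>R fund X q" "fund 0 q = 0"
  using linear_lift_deriv[OF _ rep(1)[OF assms]]
  by (auto simp: fund_def fun_eq_iff plus_fun_def fun_diff_def scaleR_fun_def matmul_simps zero_fun_def
      linear_add linear_diff linear_cmul linear_0)

lemma velocityE:
  assumes "X \<in> velocities S"
  obtains c where "smooth_on UNIV c" "\<And>t. c t \<in> S" "c 0 = mat 1" "(c has_vector_derivative X) (at 0)"
  using assms unfolding velocities_def by blast

lemma path_left:
  assumes "smooth_fun f" "a \<in> SO5" "\<And>t. c t \<in> SO5" "c 0 = mat 1"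
    "(c has_vector_derivative X) (at 0)"
  shows "((\<lambda>t. f (act (c t) (coset a))) has_real_derivative lift_deriv f a (X ** a)) (at 0)"
proof -
  have "((\<lambda>t. c t ** a) has_vector_derivative X ** a) (at 0)"
    by (rule bounded_linear.has_vector_derivative[OF bounded_linear_matmul_right assms(5)])
  from path_lift_deriv[OF assms(1) _ this] show ?thesis
    using assms by (simp add: SO5_mult act_coset)
qed

lemma fund_path:
  assumes "smooth_fun f" "q \<in> M" "\<And>t. c t \<in> SO5" "c 0 = mat 1"
    "(c has_vector_derivative X) (at 0)"
  shows "((\<lambda>t. f (act (c t) q)) has_real_derivative fund X q f) (at 0)"
  using path_left[OF assms(1) rep(1)[OF assms(2)] assms(3-5)] assms(1) rep(2)[OF assms(2)]
  by (simp add: fund_def)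

text \<open>The chosen representative disappears because both sides are the derivative of
  \<open>f\<close> along the orbit curve of \<open>coset a\<close>, which depends on the point
  alone.\<close>

lemma fund_coset:
  assumes "skew X" "a \<in> SO5" "smooth_fun f"
  shows "fund X (coset a) f = lift_deriv f a (X ** a)"
proof -
  obtain c where c: "\<And>t. c t \<in> SO5" "c 0 = mat 1" "(c has_vector_derivative X) (at 0)"
    using velocityE[OF velocities_SO5[OF assms(1)]] by metis
  show ?thesis
    using path_left[OF assms(3,2) c] fund_path[OF assms(3) coset_in_M[OF assms(2)] c]
    by (rule DERIV_unique[symmetric])
qed

lemma fund_local_lift:
  assumes "skew X" "a \<in> SO5" "a \<in> U" "local_lift f U F" "smooth_fun f"
  shows "fund X (coset a) f = frechet_derivative F (at a) (X ** a)"
proof -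
  obtain c where c: "\<And>t. c t \<in> SO5" "c 0 = mat 1" "(c has_vector_derivative X) (at 0)"
    using velocityE[OF velocities_SO5[OF assms(1)]] by metis
  have d: "((\<lambda>t. c t ** a) has_vector_derivative X ** a) (at 0)"
    by (rule bounded_linear.has_vector_derivative[OF bounded_linear_matmul_right c(3)])
  have "((\<lambda>t. f (coset (c t ** a))) has_real_derivative frechet_derivative F (at (c 0 ** a)) (X ** a)) (at 0)"
    by (rule path_derivative[OF assms(4) _ d]) (use assms c in \<open>auto simp: SO5_mult\<close>)
  then show ?thesis
    using fund_path[OF assms(5) coset_in_M[OF assms(2)] c] DERIV_unique
    by (simp add: act_coset c)
qed

lemma fund_const:
  assumes "skew X" "q \<in> M" shows "fund X q (\<lambda>p. c) = 0"
proof -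
  obtain d where d: "\<And>t. d t \<in> SO5" "d 0 = mat 1" "(d has_vector_derivative X) (at 0)"
    using velocityE[OF velocities_SO5[OF assms(1)]] by metis
  show ?thesis
    by (rule DERIV_unique[OF fund_path[OF smooth_fun_const assms(2) d] DERIV_const])
qed

lemma smooth_fun_fund:
  assumes "skew X" "smooth_fun f" shows "smooth_fun (\<lambda>q. fund X q f)"
  unfolding smooth_fun_iff
proof
  fix a assume a: "a \<in> SO5"
  obtain U F where F: "a \<in> U" "local_lift f U F" using smooth_funE[OF assms(2) a] .
  \<comment> \<open>The field \<open>X ** x\<close> is defined on all matrices, so differentiating
    an extension of \<open>f\<close> along it yields an extension of the derivative.\<close>
  have "local_lift (\<lambda>q. fund X q f) U (\<lambda>x. frechet_derivative F (at x) (X ** x))"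
    using F(2) fund_local_lift[OF assms(1) _ _ F(2) assms(2)]
    unfolding local_lift_def by (auto intro!: smooth_on_derivative_along bounded_linear_matmul_left)
  with F show "\<exists>U F. a \<in> U \<and> local_lift (\<lambda>q. fund X q f) U F" by blast
qed

lemma fund_tangent:
  assumes "skew X" "q \<in> M" shows "fund X q \<in> tangent_space q"
proof -
  obtain c where c: "smooth_on UNIV c" "\<And>t. c t \<in> SO5" "c 0 = mat 1" "(c has_vector_derivative X) (at 0)"
    using velocityE[OF velocities_SO5[OF assms(1)]] by metis
  let ?\<gamma> = "\<lambda>t. act (c t) q"
  obtain a where a: "a \<in> SO5" "q = coset a" using assms(2) unfolding M_def by auto
  have "smooth_on {-1<..<1} (\<lambda>t. f (?\<gamma> t))" if "smooth_fun f" for f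
    unfolding a act_coset using c a that
    by (intro smooth_on_path smooth_on_bounded_linear_compose[OF _ bounded_linear_matmul_right]
        smooth_on_subset[OF c(1)]) (auto simp: SO5_mult)
  then have "smooth_curve 1 ?\<gamma>"
    unfolding smooth_curve_def using act_in_M[OF c(2) assms(2)] by auto
  moreover have "velocity ?\<gamma> = fund X q"
    using DERIV_imp_deriv[OF fund_path[OF _ assms(2) c(2-4)]]
    by (auto simp: velocity_def fun_eq_iff fund_def)
  ultimately show ?thesis
    unfolding tangent_space_def mem_Collect_eq
    by (intro exI[of _ ?\<gamma>] exI[of _ 1]) (auto simp: c act_one)
qed

lemma vector_field_fund: "skew X \<Longrightarrow> vector_field (fund X)"
  unfolding vector_field_def using fund_tangent smooth_fun_fund by blast

text \<open>For a left action the fundamental fields form an anti-homomorphism, hence the reversed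
  commutator. The second derivatives of the extension cancel by symmetry and the first-order terms
  remain.\<close>

lemma fund_bracket:
  assumes "skew X" "skew Y" "q \<in> M"
  shows "lie_bracket (fund X) (fund Y) q = fund (commutator Y X) q"
proof
  fix f
  obtain a where a: "a \<in> SO5" "q = coset a" using assms(3) unfolding M_def by auto
  show "lie_bracket (fund X) (fund Y) q f = fund (commutator Y X) q f"
  proof (cases "smooth_fun f")
    case False
    \<comment> \<open>On non-smooth functions fundamental vectors are 0 by definition, so both sides
      vanish.\<close>
    then have "fund Z p f = 0" for Z p by (simp add: fund_def)
    then show ?thesis by (simp add: lie_bracket_def fund_const assms)
  next
    case True
    obtain U F where F: "a \<in> U" "local_lift f U F" using smooth_funE[OF True a(1)] .
    have U: "open U" "smooth_on U F" using F(2) unfolding local_lift_def by auto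
    have Fd: "F differentiable (at a)" using U F smooth_on_differentiable by blast
    have second: "fund X q (\<lambda>p. fund Y p f) =
        frechet_derivative (\<lambda>x. frechet_derivative F (at x) (Y ** a)) (at a) (X ** a) +
        frechet_derivative F (at a) (Y ** X ** a)" if "skew X" "skew Y" for X Y
    proof -
      let ?G = "\<lambda>x. frechet_derivative F (at x) (Y ** x)"
      have G: "local_lift (\<lambda>q. fund Y q f) U ?G"
        using U fund_local_lift[OF that(2) _ _ F(2) True]
        unfolding local_lift_def by (auto intro!: smooth_on_derivative_along bounded_linear_matmul_left)
      have d: "((\<lambda>x. frechet_derivative F (at x) b) has_derivative
          frechet_derivative (\<lambda>x. frechet_derivative F (at x) b) (at a)) (at a)" for b
        using U F(1) by (intro has_derivative_frechet smooth_on_differentiable smooth_on_derivative)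
      have "((\<lambda>x. \<Sum>b\<in>Basis. ((Y ** x) \<bullet> b) *\<^sub>R frechet_derivative F (at x) b) has_derivative
        (\<lambda>v. \<Sum>b\<in>Basis. ((Y ** a) \<bullet> b) *\<^sub>R frechet_derivative (\<lambda>x. frechet_derivative F (at x) b) (at a) v
            + ((Y ** v) \<bullet> b) *\<^sub>R frechet_derivative F (at a) b)) (at a)"
        by (intro has_derivative_sum bounded_bilinear.FDERIV[OF bounded_bilinear_scaleR] d
            bounded_linear.has_derivative[OF bounded_linear_inner_left]
            bounded_linear_imp_has_derivative bounded_linear_matmul_left)
      then have "(?G has_derivative
        (\<lambda>v. \<Sum>b\<in>Basis. ((Y ** a) \<bullet> b) *\<^sub>R frechet_derivative (\<lambda>x. frechet_derivative F (at x) b) (at a) v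
            + ((Y ** v) \<bullet> b) *\<^sub>R frechet_derivative F (at a) b)) (at a)"
        by (rule has_derivative_transform_within_open[OF _ U(1) F(1)])
           (intro linear_frechet_euclidean[symmetric] smooth_on_differentiable[OF U(2)])
      then have "frechet_derivative ?G (at a) (X ** a) =
         (\<Sum>b\<in>Basis. ((Y ** a) \<bullet> b) *\<^sub>R frechet_derivative (\<lambda>x. frechet_derivative F (at x) b) (at a) (X ** a))
         + (\<Sum>b\<in>Basis. ((Y ** (X ** a)) \<bullet> b) *\<^sub>R frechet_derivative F (at a) b)"
        by (simp add: frechet_derivative_eqI sum.distrib)
      also have "(\<Sum>b\<in>Basis. ((Y ** (X ** a)) \<bullet> b) *\<^sub>R frechet_derivative F (at a) b) =
          frechet_derivative F (at a) (Y ** X ** a)"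
        using linear_frechet_euclidean[OF Fd, of "Y ** (X ** a)"] by (simp add: matrix_mul_assoc)
      \<comment> \<open>Symmetry moves \<open>b\<close> into the slot in which the derivative is
        linear, so that the sum over \<open>Basis\<close> collapses; a second exchange restores the
        order.\<close>
      also have "(\<Sum>b\<in>Basis. ((Y ** a) \<bullet> b) *\<^sub>R frechet_derivative (\<lambda>x. frechet_derivative F (at x) b) (at a) (X ** a))
         = (\<Sum>b\<in>Basis. ((Y ** a) \<bullet> b) *\<^sub>R frechet_derivative (\<lambda>x. frechet_derivative F (at x) (X ** a)) (at a) b)"
        by (simp add: second_derivative_symmetric[OF U(1) F(1) U(2), of _ "X ** a"])
      also have "\<dots> = frechet_derivative (\<lambda>x. frechet_derivative F (at x) (X ** a)) (at a) (Y ** a)"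
        by (rule linear_frechet_euclidean[symmetric])
           (intro smooth_on_differentiable[of U] smooth_on_derivative U F)
      also have "\<dots> = frechet_derivative (\<lambda>x. frechet_derivative F (at x) (Y ** a)) (at a) (X ** a)"
        by (rule second_derivative_symmetric[OF U(1) F(1) U(2)])
      finally show ?thesis
        using fund_local_lift[OF that(1) a(1) F(1) G smooth_fun_fund[OF that(2) True]] a by simp
    qed
    have "lie_bracket (fund X) (fund Y) q f =
        frechet_derivative F (at a) (Y ** X ** a) - frechet_derivative F (at a) (X ** Y ** a)"
      unfolding lie_bracket_def second[OF assms(1,2)] second[OF assms(2,1)]
      by (simp add: second_derivative_symmetric[OF U(1) F(1) U(2), of "Y ** a"])
    also have "\<dots> = frechet_derivative F (at a) (commutator Y X ** a)"
      by (simp add: commutator_def matmul_simps linear_diff[OF linear_frechet_derivative[OF Fd]])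
    also have "\<dots> = fund (commutator Y X) q f"
      using fund_local_lift[OF skew_commutator[OF assms(2,1)] a(1) F True] a by simp
    finally show ?thesis .
  qed
qed

text \<open>A curve \<open>a ** c t\<close> with \<open>c\<close> in the isotropy group stays in one
  coset, and its velocity is \<open>a ** Z = conj_mat a Z ** a\<close>.\<close>

lemma fund_zero:
  assumes "block_diagonal Z" "skew Z" "a \<in> SO5"
  shows "fund (conj_mat a Z) (coset a) = 0"
proof
  fix f
  obtain c where c: "\<And>t. c t \<in> SO3xSO2" "c 0 = mat 1" "(c has_vector_derivative Z) (at 0)"
    using velocityE[OF velocities_SO3xSO2[OF assms(2,1)]] by metis
  have co: "coset (a ** c t) = coset a" for t
  proof -
    have "c t \<in> SO5" "c t ** J = J ** c t" using c(1)[of t] by (auto simp: SO3xSO2_iff)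
    then show ?thesis
      using assms(3) by (subst coset_eq_iff) (simp_all add: SO5_mult conj_mat_eq_iff SO5_cancel)
  qed
  show "fund (conj_mat a Z) (coset a) f = 0 f"
  proof (cases "smooth_fun f")
    case True
    have d: "((\<lambda>t. a ** c t) has_vector_derivative a ** Z) (at 0)"
      by (rule bounded_linear.has_vector_derivative[OF bounded_linear_matmul_left c(3)])
    have "((\<lambda>t. f (coset (a ** c t))) has_real_derivative lift_deriv f (a ** c 0) (a ** Z)) (at 0)"
      by (rule path_lift_deriv[OF True _ d]) (use c assms in \<open>auto simp: SO5_mult SO3xSO2_SO5\<close>)
    then have "lift_deriv f a (a ** Z) = 0"
      using DERIV_unique[OF _ DERIV_const] by (simp add: co c)
    then show ?thesis
      using fund_coset[OF skew_conj_mat[OF assms(2)] assms(3) True] SO5D[OF assms(3)]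
      by (simp add: conj_mat_def flip: matrix_mul_assoc)
  qed (simp add: fund_def)
qed

section \<open>Lifting curves to the group\<close>

text \<open>For unit vectors, the product of the reflections in the hyperplanes orthogonal to
  \<open>e\<close> and then to \<open>e + w\<close>: the rotation in their plane taking
  \<open>e\<close> to \<open>w\<close>, singular only at \<open>w = - e\<close>.\<close>

definition rotate_to :: "real^'n \<Rightarrow> real^'n \<Rightarrow> real^'n^'n"
  where "rotate_to e w = mat 1 - inverse (1 + e \<bullet> w) *\<^sub>R outer (e + w) (e + w) + 2 *\<^sub>R outer w e"

lemma rotate_to_vec:
  "rotate_to e w *v x = x - (inverse (1 + e \<bullet> w) * ((e + w) \<bullet> x)) *\<^sub>R (e + w) + (2 * (e \<bullet> x)) *\<^sub>R w"
  by (simp add: rotate_to_def matrix_vector_mult_add_rdistrib matrix_vector_mult_diff_rdistrib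
      scaleR_matrix_vector_assoc[symmetric] outer_mult_vec)

lemma rotate_to_works:
  assumes "e \<bullet> e = 1" "w \<bullet> w = 1" "1 + e \<bullet> w \<noteq> 0"
  shows "rotate_to e w *v e = w"
    and "x \<bullet> e = 0 \<Longrightarrow> x \<bullet> w = 0 \<Longrightarrow> rotate_to e w *v x = x"
    and "orthogonal_matrix (rotate_to e w)"
proof -
  show "rotate_to e w *v e = w"
    using assms by (simp add: rotate_to_vec inner_add_left inner_commute[of w e] scaleR_2)
  show "rotate_to e w *v x = x" if "x \<bullet> e = 0" "x \<bullet> w = 0"
    using that by (simp add: rotate_to_vec inner_add_left inner_add_right inner_commute[of _ x])
  define c where "c = inverse (1 + e \<bullet> w)"
  have c: "c * (1 + e \<bullet> w) = 1" using assms by (simp add: c_def)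
  let ?s = "e + w"
  have s: "?s \<bullet> ?s = 2 * (1 + e \<bullet> w)" "?s \<bullet> w = 1 + e \<bullet> w" "w \<bullet> ?s = 1 + e \<bullet> w"
    using assms by (auto simp: inner_add_left inner_add_right inner_commute)
  have "transpose (rotate_to e w) ** rotate_to e w =
     (mat 1 - c *\<^sub>R outer ?s ?s + 2 *\<^sub>R outer e w) ** (mat 1 - c *\<^sub>R outer ?s ?s + 2 *\<^sub>R outer w e)"
    by (simp add: rotate_to_def transpose_mat c_def)
  \<comment> \<open>Products of \<open>c\<close> with inner products are kept as multiples of
    \<open>c * (1 + e \<bullet> w)\<close>, which is 1, so that the inverse drops out.\<close>
  also have "\<dots> = mat 1 - (2 * c) *\<^sub>R outer ?s ?s + (2 * c * (c * (1 + e \<bullet> w))) *\<^sub>R outer ?s ?s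
      + 2 *\<^sub>R outer w e + 2 *\<^sub>R outer e w - (2 * (c * (1 + e \<bullet> w))) *\<^sub>R outer ?s e
      - (2 * (c * (1 + e \<bullet> w))) *\<^sub>R outer e ?s + 4 *\<^sub>R outer e e"
    by (simp add: matmul_simps outer_mult s assms del: distrib_left_numeral)
       (simp add: vec_eq_iff algebra_simps)
  also have "\<dots> = mat 1"
    unfolding c by (simp add: outer_linear) (simp add: vec_eq_iff algebra_simps)
  finally show "orthogonal_matrix (rotate_to e w)" by (simp add: orthogonal_matrix)
qed

abbreviation e4 :: "real^(3+2)" where "e4 \<equiv> axis (Inr 1) 1"
abbreviation e5 :: "real^(3+2)" where "e5 \<equiv> axis (Inr 2) 1"

text \<open>A section of \<open>a \<mapsto> conj_mat a J\<close> over a neighbourhood of \<open>J\<close>: \<open>(plane_vec A, A *v plane_vec A)\<close> is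
  an oriented orthonormal basis of the image of \<open>A\<close>, and \<open>(e4, e5)\<close> is rotated to it in two steps.\<close>

definition plane_vec :: "mat5 \<Rightarrow> real^(3+2)"
  where "plane_vec A = inverse (norm (A *v (A *v e4))) *\<^sub>R (- (A *v (A *v e4)))"

definition first_rot :: "mat5 \<Rightarrow> mat5"
  where "first_rot A = rotate_to e4 (plane_vec A)"

definition section_at :: "mat5 \<Rightarrow> mat5"
  where "section_at A = rotate_to (first_rot A *v e5) (A *v plane_vec A) ** first_rot A"

lemma orthogonal_matrix_inner:
  "orthogonal_matrix Q \<Longrightarrow> (Q *v x) \<bullet> (Q *v y) = x \<bullet> (y :: real^'n)"
  by (simp add: orthogonal_matrix_def dot_lmul_matrix[symmetric] vector_matrix_mul_rid
      matrix_vector_mul_assoc[symmetric] flip: transpose_matrix_vector)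
     (metis dot_lmul_matrix matrix_vector_mul_assoc matrix_vector_mul_lid transpose_matrix_vector)

text \<open>Minus the square of \<open>A\<close> is the orthogonal projection onto the image plane,
  in which \<open>A\<close> is a quarter turn. The three conditions say that the projection of
  \<open>e4\<close> is nonzero and that neither rotation meets an antipodal pair.\<close>

lemma section_at_works:
  assumes b: "orthogonal_matrix b" "A = conj_mat b J"
    and ne: "A *v (A *v e4) \<noteq> 0" "1 + e4 \<bullet> plane_vec A \<noteq> 0"
      "1 + (first_rot A *v e5) \<bullet> (A *v plane_vec A) \<noteq> 0"
  shows "orthogonal_matrix (section_at A)" "conj_mat (section_at A) J = A"
proof -
  have e: "e4 \<bullet> e4 = 1" "e5 \<bullet> e5 = 1" "e4 \<bullet> e5 = 0" "e5 \<bullet> e4 = 0"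
    by (simp_all add: inner_axis_axis)
  have cJ: "conj_mat Q J = outer (Q *v e5) (Q *v e4) - outer (Q *v e4) (Q *v e5)" for Q :: mat5
    by (simp add: J_def conj_mat_linear) (simp add: conj_mat_def matrix_mult_outer)
  define b4 b5 where "b4 = b *v e4" and "b5 = b *v e5"
  have bb: "b4 \<bullet> b4 = 1" "b5 \<bullet> b5 = 1" "b4 \<bullet> b5 = 0" "b5 \<bullet> b4 = 0"
    unfolding b4_def b5_def orthogonal_matrix_inner[OF b(1)] e by simp_all
  have A: "A = outer b5 b4 - outer b4 b5" unfolding b(2) cJ b4_def b5_def ..
  have Av: "A *v x = (b4 \<bullet> x) *\<^sub>R b5 - (b5 \<bullet> x) *\<^sub>R b4" for x
    by (simp add: A matrix_vector_mult_diff_rdistrib outer_mult_vec)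
  let ?w = "plane_vec A" let ?w' = "A *v ?w" let ?u = "first_rot A *v e5"
  have ww: "?w \<bullet> ?w = 1"
    using ne(1) by (simp add: plane_vec_def dot_square_norm power2_eq_square)
  obtain x y where w: "?w = x *\<^sub>R b4 + y *\<^sub>R b5"
  proof
    show "?w = (inverse (norm (A *v (A *v e4))) * (b4 \<bullet> e4)) *\<^sub>R b4 +
        (inverse (norm (A *v (A *v e4))) * (b5 \<bullet> e4)) *\<^sub>R b5"
      unfolding plane_vec_def
      by (simp add: Av inner_diff_right bb algebra_simps)
  qed
  have w': "?w' = x *\<^sub>R b5 - y *\<^sub>R b4"
    by (simp add: Av) (simp add: w inner_add_right bb)
  have xy: "x * x + y * y = 1"
    using ww unfolding w by (simp add: inner_add_left inner_add_right bb)
  have ww': "?w' \<bullet> ?w' = 1" "?w \<bullet> ?w' = 0"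
    using xy unfolding w' unfolding w
    by (simp_all add: inner_add_left inner_diff_left inner_diff_right inner_add_right bb)
  note r1 = rotate_to_works[OF e(1) ww ne(2), folded first_rot_def]
  have u: "?u \<bullet> ?u = 1" "?w \<bullet> ?u = 0"
    using orthogonal_matrix_inner[OF r1(3), of e5 e5] orthogonal_matrix_inner[OF r1(3), of e4 e5]
    by (simp_all add: e r1(1))
  note r2 = rotate_to_works[OF u(1) ww'(1) ne(3)]
  show "orthogonal_matrix (section_at A)"
    unfolding section_at_def by (intro orthogonal_matrix_mul r1(3) r2(3))
  \<comment> \<open>The second rotation leaves \<open>plane_vec A\<close> in place, since it is
    orthogonal to both vectors that define that rotation.\<close>
  have s: "section_at A *v e4 = ?w" "section_at A *v e5 = ?w'"
    using r2(2)[OF u(2) ww'(2)] r2(1) r1(1)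
    by (simp_all add: section_at_def flip: matrix_vector_mul_assoc)
  \<comment> \<open>Passing to another basis of the plane multiplies the difference of outer
    products by the determinant of the change, here \<open>x * x + y * y\<close>.\<close>
  have "outer (x *\<^sub>R b5 - y *\<^sub>R b4) (x *\<^sub>R b4 + y *\<^sub>R b5) -
      outer (x *\<^sub>R b4 + y *\<^sub>R b5) (x *\<^sub>R b5 - y *\<^sub>R b4) =
      (x * x + y * y) *\<^sub>R (outer b5 b4 - outer b4 b5)"
    by (simp add: outer_linear algebra_simps)
  then show "conj_mat (section_at A) J = A"
    unfolding cJ s w' unfolding w xy A[symmetric] by simp
qed

lemma differentiable_bilinear:
  assumes "bounded_bilinear p" "f differentiable (at x)" "g differentiable (at x)"
  shows "(\<lambda>x. p (f x) (g x)) differentiable (at x)"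
  using bounded_bilinear.FDERIV[OF assms(1) has_derivative_frechet[OF assms(2)]
      has_derivative_frechet[OF assms(3)]] by (rule differentiableI)

lemma bounded_bilinear_matrix_vector_mult:
  "bounded_bilinear ((*v) :: real^'n^'m \<Rightarrow> real^'n \<Rightarrow> real^'m)"
  by (simp flip: bilinear_conv_bounded_bilinear add: bilinear_def linear_iff vec_eq_iff
      matrix_vector_mult_def sum.distrib sum_distrib_left algebra_simps)

lemma differentiable_rotate_to:
  fixes e w :: "real \<Rightarrow> real^'n"
  assumes "e differentiable (at t)" "w differentiable (at t)" "1 + e t \<bullet> w t \<noteq> 0"
  shows "(\<lambda>t. rotate_to (e t) (w t)) differentiable (at t)"
  unfolding rotate_to_def
  by (intro differentiable_add differentiable_diff differentiable_const assms
      differentiable_bilinear[OF bounded_bilinear_outer] differentiable_inverse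
      differentiable_bilinear[OF bounded_bilinear_scaleR]
      differentiable_bilinear[OF bounded_bilinear_inner])

text \<open>At \<open>J\<close> both rotations are the identity, so every norm and denominator is
  nonzero at time 0; continuity keeps the conditions valid nearby.\<close>

lemma section_at_differentiable:
  assumes A: "A differentiable (at (0::real))" "A 0 = J"
  shows "(\<lambda>t. section_at (A t)) differentiable (at 0)" "section_at (A 0) = mat 1"
    "eventually (\<lambda>t. A t *v (A t *v e4) \<noteq> 0) (nhds 0)"
    "eventually (\<lambda>t. 1 + e4 \<bullet> plane_vec (A t) \<noteq> 0) (nhds 0)"
    "eventually (\<lambda>t. 1 + (first_rot (A t) *v e5) \<bullet> (A t *v plane_vec (A t)) \<noteq> 0) (nhds 0)"
proof -
  have J: "J *v e4 = e5" "J *v e5 = - e4"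
    by (simp_all add: J_def matrix_vector_mult_diff_rdistrib outer_mult_vec inner_axis_axis)
  have J4: "J *v (J *v e4) = - e4" by (simp only: J)
  have pv: "plane_vec (A 0) = e4" unfolding plane_vec_def A(2) J4 by simp
  have e: "e4 \<bullet> e4 = 1" "e5 \<bullet> e5 = 1" by (simp_all add: inner_axis_axis)
  have r1: "rotate_to x x = mat 1" if "x \<bullet> x = 1" for x :: "real^(3+2)"
    using that by (simp add: rotate_to_def outer_linear flip: scaleR_2)
  have fr: "first_rot (A 0) = mat 1" unfolding first_rot_def pv by (rule r1[OF e(1)])
  show s0: "section_at (A 0) = mat 1"
    unfolding section_at_def fr pv by (simp add: A(2) J r1[OF e(2)])
  note dmv = differentiable_bilinear[OF bounded_bilinear_matrix_vector_mult]
  have v: "(\<lambda>t. A t *v (A t *v e4)) differentiable (at 0)"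
    by (intro dmv A differentiable_const)
  have vn: "(\<lambda>t. norm (A t *v (A t *v e4))) differentiable (at 0)"
    using differentiable_chain_at[OF v, of norm] A(2) J4
    by (simp add: o_def differentiable_norm_at)
  have pvd: "(\<lambda>t. plane_vec (A t)) differentiable (at 0)"
    unfolding plane_vec_def
    by (intro differentiable_bilinear[OF bounded_bilinear_scaleR] differentiable_inverse vn
        differentiable_minus v) (simp add: A(2) J4)
  have frd: "(\<lambda>t. first_rot (A t)) differentiable (at 0)"
    unfolding first_rot_def
    by (intro differentiable_rotate_to differentiable_const pvd) (simp add: pv inner_axis_axis)
  have n3: "1 + (first_rot (A 0) *v e5) \<bullet> (A 0 *v plane_vec (A 0)) \<noteq> 0"
    unfolding fr pv unfolding A(2) by (simp add: J inner_axis_axis)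
  show "(\<lambda>t. section_at (A t)) differentiable (at 0)"
    unfolding section_at_def
    by (intro differentiable_bilinear[OF bounded_bilinear_matrix_mult] frd differentiable_rotate_to
        dmv differentiable_const A pvd n3)
  have ev: "eventually (\<lambda>t. f t \<noteq> 0) (nhds 0)"
    if "f differentiable (at 0)" "f 0 \<noteq> 0" for f :: "real \<Rightarrow> 'b::real_normed_vector"
    using tendsto_imp_eventually_ne[OF differentiable_imp_continuous_within[OF that(1),
        unfolded continuous_within] that(2)] that(2)
    by (simp add: eventually_nhds_conv_at)
  show "eventually (\<lambda>t. A t *v (A t *v e4) \<noteq> 0) (nhds 0)"
    by (rule ev[OF v]) (simp add: A(2) J4)
  show "eventually (\<lambda>t. 1 + e4 \<bullet> plane_vec (A t) \<noteq> 0) (nhds 0)"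
    by (rule ev) (intro differentiable_add differentiable_const pvd
        differentiable_bilinear[OF bounded_bilinear_inner], simp add: pv inner_axis_axis)
  show "eventually (\<lambda>t. 1 + (first_rot (A t) *v e5) \<bullet> (A t *v plane_vec (A t)) \<noteq> 0) (nhds 0)"
    by (rule ev) (intro differentiable_add differentiable_const pvd frd dmv A
        differentiable_bilinear[OF bounded_bilinear_inner], rule n3)
qed

text \<open>The section is only known to be orthogonal; near the identity its determinant is
  positive and hence 1.\<close>

lemma eventually_det_1:
  fixes r :: "real \<Rightarrow> real^'n^'n"
  assumes "r differentiable (at 0)" "r 0 = mat 1" "eventually (\<lambda>t. orthogonal_matrix (r t)) (nhds 0)"
  shows "eventually (\<lambda>t. det (r t) = 1) (nhds 0)"
proof -
  have "(r \<longlongrightarrow> r 0) (at 0)"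
    using differentiable_imp_continuous_within[OF assms(1)] by (simp add: continuous_within)
  then have "((\<lambda>t. det (r t)) \<longlongrightarrow> det (r 0)) (at 0)"
    unfolding det_def by (intro tendsto_intros)
  from order_tendstoD(1)[OF this, of 0] have "eventually (\<lambda>t. det (r t) > 0) (at 0)"
    by (simp add: assms(2))
  then have "eventually (\<lambda>t. det (r t) > 0) (nhds 0)"
    by (simp add: eventually_nhds_conv_at assms(2))
  with assms(3) show ?thesis
    by eventually_elim (use det_orthogonal_matrix in fastforce)
qed

text \<open>Embeds \<open>M\<close> as the adjoint orbit of \<open>J\<close>.\<close>

definition orbit_map :: "point \<Rightarrow> mat5"
  where "orbit_map q = conj_mat (rep q) J"

lemma orbit_map_coset: "a \<in> SO5 \<Longrightarrow> orbit_map (coset a) = conj_mat a J"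
  unfolding orbit_map_def
  using coset_eq_iff[of "rep (coset a)" a] rep[OF coset_in_M] by simp

text \<open>Smooth curves in \<open>M\<close> are known only through smooth functions; these entries
  are the test functions that turn such a curve into a differentiable curve of matrices.\<close>

lemma smooth_orbit_map: "smooth_fun (\<lambda>p. orbit_map p $ i $ j)"
proof (rule smooth_fun_lift)
  have "bounded_linear (\<lambda>x :: mat5. x $ i $ j)"
    using bounded_linear_compose[OF bounded_linear_vec_nth[of j] bounded_linear_vec_nth[of i]]
    by (simp add: o_def)
  then show "smooth_on UNIV (\<lambda>a. conj_mat a J $ i $ j)"
    unfolding conj_mat_def
    by (intro smooth_on_bounded_linear_compose[where L = "\<lambda>x. x $ i $ j"] open_UNIV
        smooth_on_bilinear[OF _ bounded_bilinear_matrix_mult] smooth_on_const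
        smooth_on_bounded_linear bounded_linear_transpose bounded_linear_ident)
qed (simp add: orbit_map_coset)

lemma differentiable_matrixI:
  fixes A :: "real \<Rightarrow> real^'n^'m"
  assumes "\<And>i j. (\<lambda>t. A t $ i $ j) differentiable (at x)"
  shows "A differentiable (at x)"
proof -
  have A: "A = (\<lambda>t. \<Sum>i\<in>UNIV. \<Sum>j\<in>UNIV. (A t $ i $ j) *\<^sub>R axis i (axis j 1))"
  proof
    fix t
    have "(\<Sum>k\<in>UNIV. \<Sum>l\<in>UNIV. (A t $ k $ l) *\<^sub>R axis k (axis l (1::real))) $ i $ j =
      (\<Sum>k\<in>UNIV. \<Sum>l\<in>UNIV. (if k = i then (if l = j then A t $ k $ l else 0) else 0))" for i :: 'm and j :: 'n
      unfolding sum_component by (intro sum.cong refl) (auto simp: axis_def)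
    also have "\<dots> i j = A t $ i $ j" for i :: 'm and j :: 'n
      by (subst sum.swap) simp
    finally show "A t = (\<Sum>k\<in>UNIV. \<Sum>l\<in>UNIV. (A t $ k $ l) *\<^sub>R axis k (axis l (1::real)))"
      by (simp add: vec_eq_iff)
  qed
  show ?thesis
    by (subst A) (intro differentiable_sum ballI differentiable_bilinear[OF bounded_bilinear_scaleR]
        differentiable_const assms finite)
qed

lemma tangentE:
  assumes "u \<in> tangent_space q"
  obtains \<gamma> \<epsilon> where "\<epsilon> > 0" "\<gamma> 0 = q" "\<And>t. \<bar>t\<bar> < \<epsilon> \<Longrightarrow> \<gamma> t \<in> M"
    "\<And>f. smooth_fun f \<Longrightarrow> ((\<lambda>t. f (\<gamma> t)) has_real_derivative u f) (at 0)"
    "\<And>f. \<not> smooth_fun f \<Longrightarrow> u f = 0"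
proof -
  obtain \<gamma> \<epsilon> where g: "u = velocity \<gamma>" "\<epsilon> > 0" "smooth_curve \<epsilon> \<gamma>" "\<gamma> 0 = q"
    using assms unfolding tangent_space_def by blast
  show thesis
  proof (rule that[of \<epsilon> \<gamma>])
    show "\<gamma> t \<in> M" if "\<bar>t\<bar> < \<epsilon>" for t
      using g(3) that unfolding smooth_curve_def by (auto simp: image_subset_iff abs_less_iff)
    fix f
    show "u f = 0" if "\<not> smooth_fun f" using that by (simp add: g velocity_def)
    assume f: "smooth_fun f"
    then have "(\<lambda>t. f (\<gamma> t)) differentiable (at 0)"
      using g(2,3) unfolding smooth_curve_def by (intro smooth_on_differentiable[of "{-\<epsilon><..<\<epsilon>}"]) auto
    then have "((\<lambda>t. f (\<gamma> t)) has_real_derivative deriv (\<lambda>t. f (\<gamma> t)) 0) (at 0)"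
      using DERIV_deriv_iff_real_differentiable by blast
    then show "((\<lambda>t. f (\<gamma> t)) has_real_derivative u f) (at 0)" by (simp add: g velocity_def f)
  qed (use g in auto)
qed

text \<open>Differentiate \<open>d t ** transpose (d t) = mat 1\<close>.\<close>

lemma has_vector_derivative_matrix_const:
  fixes d :: "real \<Rightarrow> mat5"
  assumes "(d has_vector_derivative V) (at 0)" "eventually (\<lambda>t. d t \<in> SO5) (nhds 0)"
  shows "skew (V ** transpose (d 0))"
proof -
  have "((\<lambda>t. d t ** transpose (d t)) has_vector_derivative d 0 ** transpose V + V ** transpose (d 0)) (at 0)"
    by (intro bounded_bilinear.has_vector_derivative[OF bounded_bilinear_matrix_mult]
        bounded_linear.has_vector_derivative[OF bounded_linear_transpose] assms(1))
  moreover have "eventually (\<lambda>t. d t ** transpose (d t) = mat 1) (nhds 0)"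
    using assms(2) by eventually_elim (rule SO5D)
  then have "((\<lambda>t. d t ** transpose (d t)) has_vector_derivative 0) (at 0)"
    by (subst has_vector_derivative_cong_ev[where g = "\<lambda>t. mat 1"])
       (auto simp: eventually_nhds_conv_at dest: eventually_nhds_x_imp_x)
  ultimately have "d 0 ** transpose V + V ** transpose (d 0) = 0"
    using vector_derivative_unique_at by blast
  then show ?thesis
    by (simp add: skew_def matrix_transpose_mul eq_neg_iff_add_eq_0)
qed

text \<open>The orbit curve, conjugated so as to start at \<open>J\<close>, is fed into the local
  section; translation back by \<open>a\<close> lifts the given curve to the group. The velocity of
  the lift has the form \<open>Y ** a\<close> with \<open>Y\<close> skew.\<close>

lemma tangent_eq_fund:
  assumes "u \<in> tangent_space q" "q \<in> M"
  obtains Y where "skew Y" "u = fund Y q"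
proof -
  obtain \<gamma> \<epsilon> where g: "\<epsilon> > 0" "\<gamma> 0 = q" "\<And>t. \<bar>t\<bar> < \<epsilon> \<Longrightarrow> \<gamma> t \<in> M"
    "\<And>f. smooth_fun f \<Longrightarrow> ((\<lambda>t. f (\<gamma> t)) has_real_derivative u f) (at 0)"
    "\<And>f. \<not> smooth_fun f \<Longrightarrow> u f = 0"
    using tangentE[OF assms(1)] by metis
  define a where "a = rep q"
  have a: "a \<in> SO5" "coset a = q" using rep[OF assms(2)] by (simp_all add: a_def)
  define A where "A t = conj_mat (transpose a) (orbit_map (\<gamma> t))" for t
  have om: "(\<lambda>t. orbit_map (\<gamma> t)) differentiable (at 0)"
    using g(4)[OF smooth_orbit_map] by (intro differentiable_matrixI) (auto simp: real_differentiable_def)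
  have A: "A differentiable (at 0)"
    unfolding A_def conj_mat_def
    by (intro differentiable_bilinear[OF bounded_bilinear_matrix_mult] differentiable_const om)
  have A0: "A 0 = J"
    by (simp add: A_def g(2) orbit_map_coset[OF a(1)] SO5D[OF a(1)] flip: a(2) conj_mat_mult)
  note s = section_at_differentiable[OF A A0]
  let ?r = "\<lambda>t. section_at (A t)"
  have close: "eventually (\<lambda>t. \<bar>t\<bar> < \<epsilon>) (nhds 0)"
    using g(1) by (auto simp: eventually_nhds_metric dist_real_def)
  have r: "eventually (\<lambda>t. orthogonal_matrix (?r t) \<and> conj_mat (?r t) J = A t) (nhds 0)"
    using close s(3-5)
  proof eventually_elim
    case (elim t)
    let ?b = "rep (\<gamma> t)"
    have b: "?b \<in> SO5" using rep g(3) elim(1) by simp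
    have "A t = conj_mat (transpose a ** ?b) J" by (simp add: A_def orbit_map_def conj_mat_mult)
    then show ?case
      using section_at_works[OF SO5D(1)[OF SO5_mult[OF SO5_transpose[OF a(1)] b]]] elim by simp
  qed
  have "eventually (\<lambda>t. orthogonal_matrix (?r t)) (nhds 0)"
    using r by eventually_elim simp
  from eventually_det_1[OF s(1,2) this] have dt: "eventually (\<lambda>t. det (?r t) = 1) (nhds 0)" .
  define d where "d t = a ** ?r t" for t
  have dS: "eventually (\<lambda>t. d t \<in> SO5) (nhds 0)"
    using r dt unfolding d_def
    by eventually_elim (rule SO5_mult[OF a(1)], simp add: SO5_def rotation_matrix_def)
  have dc: "eventually (\<lambda>t. coset (d t) = \<gamma> t) (nhds 0)"
    using r dS close
  proof eventually_elim
    case (elim t)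
    let ?b = "rep (\<gamma> t)"
    have b: "?b \<in> SO5" "coset ?b = \<gamma> t" using rep g(3) elim(3) by simp_all
    have "conj_mat (d t) J = conj_mat ?b J"
      using elim(1)
      by (simp add: d_def conj_mat_mult)
         (simp add: A_def orbit_map_def SO5_cancel[OF a(1)] flip: conj_mat_mult)
    then show ?case using coset_eq_iff[OF elim(2) b(1)] b(2) by simp
  qed
  have d0: "d 0 = a" by (simp add: d_def s(2))
  have "d differentiable (at 0)"
    unfolding d_def
    by (intro differentiable_bilinear[OF bounded_bilinear_matrix_mult] differentiable_const s(1))
  then obtain V where V: "(d has_vector_derivative V) (at 0)"
    using vector_derivative_works by blast
  define Y where "Y = V ** transpose a"
  have skY: "skew Y" using has_vector_derivative_matrix_const[OF V dS] by (simp add: Y_def d0)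
  have YV: "Y ** a = V" by (simp add: Y_def SO5D[OF a(1)] flip: matrix_mul_assoc)
  have "u f = fund Y q f" for f
  proof (cases "smooth_fun f")
    case True
    have D: "((\<lambda>t. f (coset (d t))) has_real_derivative lift_deriv f a V) (at 0)"
      using path_lift_deriv[OF True _ V dS] a(1) by (simp add: d0)
    have "eventually (\<lambda>t. f (coset (d t)) = f (\<gamma> t)) (nhds 0)"
      using dc by eventually_elim simp
    from DERIV_cong_ev[OF refl this refl] D
    have "((\<lambda>t. f (\<gamma> t)) has_real_derivative lift_deriv f a V) (at 0)" by blast
    then have "u f = lift_deriv f a V" using g(4)[OF True] DERIV_unique by blast
    then show ?thesis by (simp add: fund_def True YV flip: a_def)
  qed (simp add: g(5) fund_def)
  with that[OF skY] show thesis by blast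
qed

section \<open>The canonical connection\<close>

text \<open>A sum of velocities of two curves in \<open>M\<close> is not visibly a velocity; writing
  both as fundamental vectors makes it one.\<close>

lemma tangent_space_linear:
  assumes "q \<in> M" "u \<in> tangent_space q" "v \<in> tangent_space q"
  shows "u + v \<in> tangent_space q" "u - v \<in> tangent_space q" "c *\<^sub>R u \<in> tangent_space q"
    "0 \<in> tangent_space q"
proof -
  obtain X where X: "skew X" "u = fund X q" using tangent_eq_fund[OF assms(2,1)] .
  obtain Y where Y: "skew Y" "v = fund Y q" using tangent_eq_fund[OF assms(3,1)] .
  have "fund (X + Y) q \<in> tangent_space q" "fund (X - Y) q \<in> tangent_space q"
    "fund (c *\<^sub>R X) q \<in> tangent_space q" "fund 0 q \<in> tangent_space q"
    using X Y assms(1) by (auto intro!: fund_tangent skew_linear)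
  then show "u + v \<in> tangent_space q" "u - v \<in> tangent_space q" "c *\<^sub>R u \<in> tangent_space q"
    "0 \<in> tangent_space q"
    using X Y by (simp_all add: fund_linear[OF assms(1)])
qed

lemma tangent_deriv:
  assumes u: "u \<in> tangent_space q"
  shows tangent_add: "smooth_fun f \<Longrightarrow> smooth_fun h \<Longrightarrow> u (\<lambda>p. f p + h p) = u f + u h"
    and tangent_mult: "smooth_fun f \<Longrightarrow> smooth_fun h \<Longrightarrow> u (\<lambda>p. f p * h p) = u f * h q + f q * u h"
    and tangent_const: "u (\<lambda>p. c) = 0"
    and tangent_cong: "(\<And>p. p \<in> M \<Longrightarrow> f p = h p) \<Longrightarrow> u f = u h"
    and tangent_nonsmooth: "\<not> smooth_fun f \<Longrightarrow> u f = 0"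
proof -
  obtain \<gamma> \<epsilon> where g: "\<epsilon> > 0" "\<gamma> 0 = q" "\<And>t. \<bar>t\<bar> < \<epsilon> \<Longrightarrow> \<gamma> t \<in> M"
    "\<And>f. smooth_fun f \<Longrightarrow> ((\<lambda>t. f (\<gamma> t)) has_real_derivative u f) (at 0)"
    "\<And>f. \<not> smooth_fun f \<Longrightarrow> u f = 0"
    using tangentE[OF u] by metis
  show "u (\<lambda>p. f p + h p) = u f + u h" if "smooth_fun f" "smooth_fun h"
    using g(4)[OF smooth_fun_add[OF that]] DERIV_add[OF g(4)[OF that(1)] g(4)[OF that(2)]]
    by (rule DERIV_unique)
  show "u (\<lambda>p. f p * h p) = u f * h q + f q * u h" if "smooth_fun f" "smooth_fun h"
    using DERIV_unique[OF g(4)[OF smooth_fun_mult[OF that]] DERIV_mult[OF g(4)[OF that(1)] g(4)[OF that(2)]]]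
    by (simp add: g(2))
  show "u (\<lambda>p. c) = 0"
    using g(4)[OF smooth_fun_const] DERIV_const by (rule DERIV_unique)
  show "u f = u h" if fh: "\<And>p. p \<in> M \<Longrightarrow> f p = h p"
  proof (cases "smooth_fun f")
    case True
    then have h: "smooth_fun h" using smooth_fun_cong[of f h, OF fh] by blast
    have "eventually (\<lambda>t. \<bar>t\<bar> < \<epsilon>) (nhds 0)"
      using g(1) by (auto simp: eventually_nhds_metric dist_real_def)
    then have "eventually (\<lambda>t. f (\<gamma> t) = h (\<gamma> t)) (nhds 0)"
      by eventually_elim (use g(3) fh in blast)
    from DERIV_cong_ev[OF refl this refl] g(4)[OF True]
    have "((\<lambda>t. h (\<gamma> t)) has_real_derivative u f) (at 0)" by blast
    then show ?thesis using g(4)[OF h] by (rule DERIV_unique)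
  next
    case False
    then show ?thesis using smooth_fun_cong[of f h, OF fh] g(5) by simp
  qed
  show "u f = 0" if "\<not> smooth_fun f" using g(5)[OF that] .
qed

lemma tangent_sum:
  assumes "u \<in> tangent_space q" "finite I" "\<And>i. i \<in> I \<Longrightarrow> smooth_fun (f i)"
  shows "u (\<lambda>p. \<Sum>i\<in>I. f i p) = (\<Sum>i\<in>I. u (f i))"
  using assms(2,3)
  by (induction I rule: finite_induct)
     (auto simp: tangent_const[OF assms(1)] tangent_add[OF assms(1)] smooth_fun_sum)

lemma tangent_cmult:
  assumes "u \<in> tangent_space q" "smooth_fun f" shows "u (\<lambda>p. c * f p) = c * u f"
  using tangent_mult[OF assms(1) smooth_fun_const assms(2), of c] tangent_const[OF assms(1)] by simp

text \<open>A matrix-valued 1-form defined on all of \<open>M\<close>: it turns a vector field into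
  a matrix function that can be differentiated entry by entry, without local frames.\<close>

definition theta :: "point \<Rightarrow> tvector \<Rightarrow> mat5"
  where "theta q u = commutator (orbit_map q) (\<chi> i j. u (\<lambda>p. orbit_map p $ i $ j))"

text \<open>The orbit map is equivariant, so moving \<open>q\<close> by \<open>c t\<close>
  conjugates it by \<open>c t\<close>; the derivative of that is a commutator.\<close>

lemma fund_orbit_map:
  assumes "skew Y" "q \<in> M"
  shows "(\<chi> i j. fund Y q (\<lambda>p. orbit_map p $ i $ j)) = commutator Y (orbit_map q)"
proof -
  obtain a where a: "a \<in> SO5" "q = coset a" using assms(2) unfolding M_def by auto
  obtain c where c: "\<And>t. c t \<in> SO5" "c 0 = mat 1" "(c has_vector_derivative Y) (at 0)"
    using velocityE[OF velocities_SO5[OF assms(1)]] by metis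
  have om: "orbit_map (act (c t) q) = c t ** orbit_map q ** transpose (c t)" for t
    using orbit_map_coset[OF a(1)] orbit_map_coset[OF SO5_mult[OF c(1) a(1)], of t]
    by (simp add: a act_coset conj_mat_mult) (simp add: conj_mat_def)
  have "((\<lambda>t. c t ** orbit_map q ** transpose (c t)) has_vector_derivative
      c 0 ** orbit_map q ** transpose Y + Y ** orbit_map q ** transpose (c 0)) (at 0)"
    by (intro bounded_bilinear.has_vector_derivative[OF bounded_bilinear_matrix_mult]
        bounded_linear.has_vector_derivative[OF bounded_linear_matmul_right]
        bounded_linear.has_vector_derivative[OF bounded_linear_transpose] c(3))
  then have d: "((\<lambda>t. orbit_map (act (c t) q)) has_vector_derivative commutator Y (orbit_map q)) (at 0)"
    using assms(1) by (simp add: om c(2) commutator_def skew_def matmul_simps)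
  have "fund Y q (\<lambda>p. orbit_map p $ i $ j) = commutator Y (orbit_map q) $ i $ j" for i j
  proof -
    have "((\<lambda>t. orbit_map (act (c t) q) $ i $ j) has_vector_derivative commutator Y (orbit_map q) $ i $ j) (at 0)"
      by (intro bounded_linear.has_vector_derivative[OF bounded_linear_vec_nth] d)
    then show ?thesis
      using DERIV_unique[OF fund_path[OF smooth_orbit_map assms(2) c]]
      by (simp add: has_real_derivative_iff_has_vector_derivative)
  qed
  then show ?thesis by (simp add: vec_eq_iff)
qed

text \<open>The map \<open>theta q\<close> is the inverse of \<open>X \<mapsto> fund X q\<close> on the complement of the isotropy algebra,
  because \<open>A = orbit_map q\<close> acts on this complement as a complex structure.\<close>

lemma theta_works:
  assumes "u \<in> tangent_space (coset a)" "a \<in> SO5"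
  obtains X where "skew X" "off_diagonal X" "theta (coset a) u = conj_mat a X"
    "fund (conj_mat a X) (coset a) = u"
proof -
  obtain Y where Y: "skew Y" "u = fund Y (coset a)"
    using tangent_eq_fund[OF assms(1) coset_in_M[OF assms(2)]] .
  define Z where "Z = conj_mat (transpose a) Y"
  have YZ: "Y = conj_mat a Z" and skZ: "skew Z"
    unfolding Z_def using SO5D[OF assms(2)] Y(1)
    by (simp_all add: skew_conj_mat flip: conj_mat_mult)
  let ?X = "commutator J (commutator Z J)"
  have "theta (coset a) u = commutator (conj_mat a J) (commutator Y (conj_mat a J))"
    unfolding theta_def Y(2) fund_orbit_map[OF Y(1) coset_in_M[OF assms(2)]] orbit_map_coset[OF assms(2)] ..
  \<comment> \<open>Conjugation carries the formula to the base point, where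
    \<open>off_diagonal_part\<close> identifies it as a projection.\<close>
  also have "\<dots> = conj_mat a ?X"
    unfolding YZ by (simp add: orthogonal_conj_mat_commutator SO5D[OF assms(2)])
  finally have 1: "theta (coset a) u = conj_mat a ?X" .
  have sk: "skew ?X" by (intro skew_commutator skew_J skZ)
  \<comment> \<open>The discarded part is block-diagonal, so its field vanishes at this
    point.\<close>
  have "fund (conj_mat a (Z - ?X)) (coset a) = 0"
    by (intro fund_zero off_diagonal_part skZ skew_linear sk assms)
  then have "fund (conj_mat a ?X) (coset a) = u"
    by (simp add: conj_mat_linear fund_linear[OF coset_in_M[OF assms(2)]] Y(2) YZ)
  with that[OF sk off_diagonal_part(1)[OF skZ] 1] show thesis .
qed

text \<open>The last claim is \<open>off_diagonal_commutator\<close> transported to \<open>q\<close>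
  by conjugation, followed by \<open>fund_zero\<close>.\<close>

lemma theta_props:
  assumes "u \<in> tangent_space q" "q \<in> M"
  shows skew_theta: "skew (theta q u)" and fund_theta: "fund (theta q u) q = u"
    and fund_commutator_theta:
      "v \<in> tangent_space q \<Longrightarrow> fund (commutator (theta q u) (theta q v)) q = 0"
proof -
  obtain a where a: "a \<in> SO5" "q = coset a" using assms(2) unfolding M_def by auto
  obtain X where X: "skew X" "off_diagonal X" "theta q u = conj_mat a X" "fund (conj_mat a X) q = u"
    using theta_works[OF _ a(1)] assms(1) unfolding a(2) by metis
  show "skew (theta q u)" "fund (theta q u) q = u" using X skew_conj_mat by simp_all
  assume v: "v \<in> tangent_space q"
  obtain Y where Y: "skew Y" "off_diagonal Y" "theta q v = conj_mat a Y"
    using theta_works[OF _ a(1)] v unfolding a(2) by metis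
  show "fund (commutator (theta q u) (theta q v)) q = 0"
    unfolding X(3) Y(3) orthogonal_conj_mat_commutator[OF SO5D(1)[OF a(1)]] unfolding a(2)
    by (intro fund_zero off_diagonal_commutator skew_commutator X Y a)
qed

lemma theta_linear:
  "theta q (u + v) = theta q u + theta q v" "theta q (c *\<^sub>R u) = c *\<^sub>R theta q u"
proof -
  have "(\<chi> i j. (u + v) (\<lambda>p. orbit_map p $ i $ j)) =
      (\<chi> i j. u (\<lambda>p. orbit_map p $ i $ j)) + (\<chi> i j. v (\<lambda>p. orbit_map p $ i $ j))"
    "(\<chi> i j. (c *\<^sub>R u) (\<lambda>p. orbit_map p $ i $ j)) = c *\<^sub>R (\<chi> i j. u (\<lambda>p. orbit_map p $ i $ j))"
    by (simp_all add: vec_eq_iff scaleR_fun_def)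
  then show "theta q (u + v) = theta q u + theta q v" "theta q (c *\<^sub>R u) = c *\<^sub>R theta q u"
    by (simp_all add: theta_def commutator_def matmul_simps algebra_simps)
qed

lemma vector_fieldD:
  assumes "vector_field X"
  shows "q \<in> M \<Longrightarrow> X q \<in> tangent_space q" "smooth_fun f \<Longrightarrow> smooth_fun (\<lambda>q. X q f)"
  using assms unfolding vector_field_def by auto

lemma smooth_theta:
  assumes "vector_field X" shows "smooth_fun (\<lambda>q. theta q (X q) $ i $ j)"
  unfolding theta_def commutator_def matrix_matrix_mult_def vector_minus_component vec_lambda_beta
  by (intro smooth_fun_diff smooth_fun_sum smooth_fun_mult smooth_orbit_map
      vector_fieldD(2)[OF assms] finite)

definition mat_deriv :: "tvector \<Rightarrow> (point \<Rightarrow> mat5) \<Rightarrow> mat5"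
  where "mat_deriv u W = (\<chi> i j. u (\<lambda>p. W p $ i $ j))"

lemma skew_mat_deriv:
  assumes "u \<in> tangent_space q" "\<And>p. p \<in> M \<Longrightarrow> skew (W p)" "\<And>i j. smooth_fun (\<lambda>p. W p $ i $ j)"
  shows "skew (mat_deriv u W)"
proof -
  have "u (\<lambda>p. W p $ j $ i) = - u (\<lambda>p. W p $ i $ j)" for i j
  proof -
    have "u (\<lambda>p. W p $ j $ i) = u (\<lambda>p. (-1) * W p $ i $ j)"
      by (rule tangent_cong[OF assms(1)], drule assms(2), drule skew_entry[of _ j i]) linarith
    also have "\<dots> = - u (\<lambda>p. W p $ i $ j)" by (subst tangent_cmult[OF assms(1,3)]) simp
    finally show ?thesis .
  qed
  then show ?thesis unfolding skew_iff mat_deriv_def vec_lambda_beta by blast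
qed

lemma skew_expand:
  assumes "linear L" "skew X"
  shows "L X = (\<Sum>i\<in>UNIV. \<Sum>j\<in>UNIV. (X $ i $ j / 2) *\<^sub>R L (elem i j))"
  using arg_cong[OF skew_eq_sum_elem[OF assms(2)], of L]
  by (simp only: linear_sum[OF assms(1)] linear_cmul[OF assms(1)])

text \<open>Expansion in the constant matrices \<open>elem i j\<close> reduces this to products of
  scalar functions. It is used with evaluation of fundamental fields, and with a metric paired
  against a field, as the form \<open>L\<close>.\<close>

lemma product_rule:
  fixes L :: "point \<Rightarrow> mat5 \<Rightarrow> real"
  assumes q: "q \<in> M" and u: "u \<in> tangent_space q"
    and W: "\<And>p. p \<in> M \<Longrightarrow> skew (W p)" "\<And>i j. smooth_fun (\<lambda>p. W p $ i $ j)"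
    and L: "\<And>p. p \<in> M \<Longrightarrow> linear (L p)" "\<And>X. skew X \<Longrightarrow> smooth_fun (\<lambda>p. L p X)"
  shows "smooth_fun (\<lambda>p. L p (W p))"
    and "u (\<lambda>p. L p (W p)) = L q (mat_deriv u W) + u (\<lambda>p. L p (W q))"
proof -
  let ?w = "\<lambda>i j p. (1 / 2) * W p $ i $ j" and ?L = "\<lambda>i j p. L p (elem i j)"
  have ex: "L p X = (\<Sum>i\<in>UNIV. \<Sum>j\<in>UNIV. (1 / 2 * X $ i $ j) * ?L i j p)" if "p \<in> M" "skew X" for p X
    using skew_expand[OF L(1)[OF that(1)] that(2)] by simp
  have sw: "smooth_fun (?w i j)" for i j
    by (intro smooth_fun_mult smooth_fun_const W)
  have sL: "smooth_fun (?L i j)" for i j by (intro L skew_elem)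
  have s: "smooth_fun (\<lambda>p. \<Sum>i\<in>UNIV. \<Sum>j\<in>UNIV. ?w i j p * ?L i j p)"
    by (intro smooth_fun_sum smooth_fun_mult[OF sw sL] finite)
  then show "smooth_fun (\<lambda>p. L p (W p))"
    by (subst smooth_fun_cong) (auto simp: ex W)
  have "u (\<lambda>p. L p (W p)) = u (\<lambda>p. \<Sum>i\<in>UNIV. \<Sum>j\<in>UNIV. ?w i j p * ?L i j p)"
    by (rule tangent_cong[OF u]) (simp add: ex W)
  also have "\<dots> = (\<Sum>i\<in>UNIV. \<Sum>j\<in>UNIV. u (\<lambda>p. ?w i j p * ?L i j p))"
    by (simp only: tangent_sum[OF u] finite smooth_fun_sum smooth_fun_mult[OF sw sL])
  also have "\<dots> = (\<Sum>i\<in>UNIV. \<Sum>j\<in>UNIV. (1 / 2 * mat_deriv u W $ i $ j) * ?L i j q) +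
      (\<Sum>i\<in>UNIV. \<Sum>j\<in>UNIV. ?w i j q * u (?L i j))"
    by (simp only: tangent_mult[OF u sw sL] tangent_cmult[OF u W(2)] sum.distrib mat_deriv_def vec_lambda_beta)
  also have "(\<Sum>i\<in>UNIV. \<Sum>j\<in>UNIV. (1 / 2 * mat_deriv u W $ i $ j) * ?L i j q) = L q (mat_deriv u W)"
    by (rule ex[OF q skew_mat_deriv[OF u W], symmetric])
  also have "(\<Sum>i\<in>UNIV. \<Sum>j\<in>UNIV. ?w i j q * u (?L i j)) = u (\<lambda>p. \<Sum>i\<in>UNIV. \<Sum>j\<in>UNIV. ?w i j q * ?L i j p)"
    by (simp only: tangent_sum[OF u] tangent_cmult[OF u sL] finite smooth_fun_sum
        smooth_fun_mult[OF smooth_fun_const sL])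
  also have "\<dots> = u (\<lambda>p. L p (W q))"
    by (rule tangent_cong[OF u]) (simp add: ex W q)
  finally show "u (\<lambda>p. L p (W p)) = L q (mat_deriv u W) + u (\<lambda>p. L p (W q))" .
qed

lemma linear_fund_eval: "q \<in> M \<Longrightarrow> linear (\<lambda>X. fund X q f)"
  by (rule linearI) (simp_all add: fund_linear scaleR_fun_def)

text \<open>The canonical connection of the symmetric space: it is the Levi-Civita connection of every
  invariant metric.\<close>

definition canonical :: connection
  where "canonical q u Y = fund (mat_deriv u (\<lambda>p. theta p (Y p))) q"

lemma skew_theta_field: "vector_field Y \<Longrightarrow> p \<in> M \<Longrightarrow> skew (theta p (Y p))"
  by (rule skew_theta[OF vector_fieldD(1)])

context
  fixes q u Y
  assumes q: "q \<in> M" and u: "u \<in> tangent_space q" and Y: "vector_field Y"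
begin

lemma skew_deriv_theta: "skew (mat_deriv u (\<lambda>p. theta p (Y p)))"
  by (intro skew_mat_deriv[OF u] skew_theta_field[OF Y] smooth_theta[OF Y])

lemma canonical_tangent: "canonical q u Y \<in> tangent_space q"
  unfolding canonical_def by (intro fund_tangent skew_deriv_theta q)

text \<open>With \<open>Y\<close> written as \<open>fund (theta p (Y p))\<close>, the Leibniz rule
  splits off the derivative of the coefficient, which is the connection; the rest is the fundamental
  field with coefficient frozen at \<open>q\<close>.\<close>

lemma deriv_field:
  assumes "smooth_fun f"
  shows "u (\<lambda>p. Y p f) = canonical q u Y f + u (\<lambda>p. fund (theta q (Y q)) p f)"
proof -
  have "u (\<lambda>p. Y p f) = u (\<lambda>p. fund (theta p (Y p)) p f)"
    by (rule tangent_cong[OF u]) (simp add: fund_theta vector_fieldD(1)[OF Y])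
  then show ?thesis
    unfolding canonical_def
    using product_rule(2)[OF q u skew_theta_field[OF Y] smooth_theta[OF Y] linear_fund_eval
        smooth_fun_fund[OF _ assms]] by simp
qed

end

text \<open>Tangent vectors are compared as functionals on all functions, so brackets have to be
  evaluated on non-smooth ones as well.\<close>

lemma bracket_nonsmooth:
  assumes "vector_field X" "vector_field Y" "q \<in> M" "\<not> smooth_fun f"
  shows "lie_bracket X Y q f = 0"
proof -
  have z: "X q (\<lambda>p. Y p f) = 0" if "vector_field X" "vector_field Y" for X Y
  proof -
    have "X q (\<lambda>p. Y p f) = X q (\<lambda>p. 0)"
      by (rule tangent_cong[OF vector_fieldD(1)[OF that(1) assms(3)]])
         (rule tangent_nonsmooth[OF vector_fieldD(1)[OF that(2)] assms(4)])
    then show ?thesis using tangent_const[OF vector_fieldD(1)[OF that(1) assms(3)]] by simp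
  qed
  show ?thesis unfolding lie_bracket_def z[OF assms(1,2)] z[OF assms(2,1)] by simp
qed

lemma fund_bracket_field:
  assumes x: "skew x" and Y: "vector_field Y" and q: "q \<in> M"
  shows "lie_bracket (fund x) Y q =
    canonical q (fund x q) Y + fund (commutator (theta q (Y q)) x) q"
proof
  fix f
  let ?y = "theta q (Y q)"
  have y: "skew ?y" and Yq: "Y q = fund ?y q"
    using skew_theta fund_theta vector_fieldD(1)[OF Y q] q by auto
  show "lie_bracket (fund x) Y q f = (canonical q (fund x q) Y + fund (commutator ?y x) q) f"
  proof (cases "smooth_fun f")
    case True
    have "lie_bracket (fund x) Y q f = canonical q (fund x q) Y f +
        lie_bracket (fund x) (fund ?y) q f"
      unfolding lie_bracket_def deriv_field[OF q fund_tangent[OF x q] Y True]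
      by (simp flip: Yq)
    then show ?thesis by (simp add: fund_bracket[OF x y q])
  next
    case False
    then show ?thesis using bracket_nonsmooth[OF vector_field_fund[OF x] Y q False]
      by (simp add: canonical_def fund_def)
  qed
qed

text \<open>The torsion at \<open>q\<close> reduces, up to sign, to the bracket of the two frozen
  fields, which vanishes there because both coefficients lie in the complement.\<close>

lemma torsion_free_canonical: "torsion_free canonical"
  unfolding torsion_free_def
proof (intro allI impI ballI ext)
  fix X Y q f assume X: "vector_field X" and Y: "vector_field Y" and q: "q \<in> M"
  let ?x = "theta q (X q)" and ?y = "theta q (Y q)"
  note tX = vector_fieldD(1)[OF X q] and tY = vector_fieldD(1)[OF Y q]
  show "(canonical q (X q) Y - canonical q (Y q) X) f = lie_bracket X Y q f"
  proof (cases "smooth_fun f")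
    case True
    have "lie_bracket X Y q f = canonical q (X q) Y f - canonical q (Y q) X f +
        lie_bracket (fund ?x) (fund ?y) q f"
      unfolding lie_bracket_def deriv_field[OF q tX Y True] deriv_field[OF q tY X True]
      by (simp add: fund_theta[OF tX q] fund_theta[OF tY q])
    then show ?thesis
      by (simp add: fund_bracket[OF skew_theta[OF tX q] skew_theta[OF tY q] q]
          fund_commutator_theta[OF tY q tX])
  next
    case False
    then show ?thesis using bracket_nonsmooth[OF X Y q False] by (simp add: canonical_def fund_def)
  qed
qed

lemma affine_connection_canonical: "affine_connection canonical"
  unfolding affine_connection_def
proof (intro conjI allI impI ballI)
  fix q u Y assume q: "q \<in> M" and u: "u \<in> tangent_space q" and Y: "vector_field Y"
  show "canonical q u Y \<in> tangent_space q" by (rule canonical_tangent[OF q u Y])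
  show "canonical q (u + v) Y = canonical q u Y + canonical q v Y" for v
  proof -
    have "mat_deriv (u + v) W = mat_deriv u W + mat_deriv v W" for W
      by (simp add: mat_deriv_def vec_eq_iff)
    then show ?thesis by (simp add: canonical_def fund_linear[OF q])
  qed
  show "canonical q (c *\<^sub>R u) Y = c *\<^sub>R canonical q u Y" for c
  proof -
    have "mat_deriv (c *\<^sub>R u) W = c *\<^sub>R mat_deriv u W" for W
      by (simp add: mat_deriv_def vec_eq_iff scaleR_fun_def)
    then show ?thesis by (simp add: canonical_def fund_linear[OF q])
  qed
  show "canonical q u (\<lambda>p. Y p + Z p) = canonical q u Y + canonical q u Z" if "vector_field Z" for Z
  proof -
    have "mat_deriv u (\<lambda>p. theta p (Y p + Z p)) =
        mat_deriv u (\<lambda>p. theta p (Y p)) + mat_deriv u (\<lambda>p. theta p (Z p))"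
      by (simp add: mat_deriv_def vec_eq_iff theta_linear tangent_add[OF u] smooth_theta Y that)
    then show ?thesis by (simp add: canonical_def fund_linear[OF q])
  qed
  show "canonical q u (\<lambda>p. f p *\<^sub>R Y p) = u f *\<^sub>R Y q + f q *\<^sub>R canonical q u Y" if f: "smooth_fun f" for f
  proof -
    have "mat_deriv u (\<lambda>p. theta p (f p *\<^sub>R Y p)) =
        u f *\<^sub>R theta q (Y q) + f q *\<^sub>R mat_deriv u (\<lambda>p. theta p (Y p))"
      by (simp add: mat_deriv_def vec_eq_iff theta_linear tangent_mult[OF u f smooth_theta[OF Y]])
    then show ?thesis
      by (simp add: canonical_def fund_linear[OF q] fund_theta[OF vector_fieldD(1)[OF Y q] q])
  qed
next
  fix X Y assume X: "vector_field X" and Y: "vector_field Y"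
  show "vector_field (\<lambda>q. canonical q (X q) Y)"
    unfolding vector_field_def
  proof (intro conjI ballI allI impI)
    show "canonical q (X q) Y \<in> tangent_space q" if "q \<in> M" for q
      by (intro canonical_tangent that vector_fieldD(1) X Y)
    fix f assume f: "smooth_fun f"
    \<comment> \<open>\<open>product_rule\<close> is stated at a point with a tangent vector; the
      coset of the identity serves as the point.\<close>
    obtain q0 where q0: "q0 \<in> M" using coset_in_M[OF SO5_one] by blast
    have "smooth_fun (\<lambda>p. fund (mat_deriv (X p) (\<lambda>p. theta p (Y p))) p f)"
    proof (rule product_rule(1)[OF q0 vector_fieldD(1)[OF X q0], where L = "\<lambda>p Z. fund Z p f"])
      show "skew (mat_deriv (X p) (\<lambda>p. theta p (Y p)))" if "p \<in> M" for p
        by (rule skew_deriv_theta[OF that vector_fieldD(1)[OF X that] Y])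
      show "smooth_fun (\<lambda>p. mat_deriv (X p) (\<lambda>p. theta p (Y p)) $ i $ j)" for i j
        by (simp add: mat_deriv_def, intro vector_fieldD(2)[OF X] smooth_theta[OF Y])
    qed (intro linear_fund_eval smooth_fun_fund f; assumption)+
    then show "smooth_fun (\<lambda>q. canonical q (X q) Y f)" by (simp add: canonical_def)
  qed
qed

section \<open>Invariant metrics\<close>

text \<open>Moving the curve \<open>act (d t) q\<close> by \<open>b\<close> gives the orbit curve of
  \<open>b ** d t ** transpose b\<close> through \<open>act b q\<close>.\<close>

lemma push_forward_fund:
  assumes b: "b \<in> SO5" and W: "skew W" and q: "q \<in> M"
  shows "push_forward b (fund W q) = fund (conj_mat b W) (act b q)"
proof
  fix f
  obtain d where d: "\<And>t. d t \<in> SO5" "d 0 = mat 1" "(d has_vector_derivative W) (at 0)"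
    using velocityE[OF velocities_SO5[OF W]] by metis
  let ?d = "\<lambda>t. b ** d t ** transpose b"
  show "push_forward b (fund W q) f = fund (conj_mat b W) (act b q) f"
  proof (cases "smooth_fun f")
    case True
    have "(?d has_vector_derivative conj_mat b W) (at 0)"
      unfolding conj_mat_def
      by (intro bounded_linear.has_vector_derivative[OF bounded_linear_matmul_left]
          bounded_linear.has_vector_derivative[OF bounded_linear_matmul_right] d)
    then have "((\<lambda>t. f (act (?d t) (act b q))) has_real_derivative fund (conj_mat b W) (act b q) f) (at 0)"
      by (intro fund_path True act_in_M b q SO5_mult SO5_transpose d) (simp_all add: d SO5D[OF b])
    moreover have "act (?d t) (act b q) = act b (act (d t) q)" for t
      using SO5D[OF b] by (simp add: act_act flip: matrix_mul_assoc)
    ultimately have "((\<lambda>t. f (act b (act (d t) q))) has_real_derivative fund (conj_mat b W) (act b q) f) (at 0)"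
      by simp
    with fund_path[OF smooth_fun_act[OF b True] q d] show ?thesis
      unfolding push_forward_def by (rule DERIV_unique)
  next
    case False
    then show ?thesis by (simp add: push_forward_def fund_def smooth_fun_act_iff[OF b])
  qed
qed

text \<open>\<open>fund\<close> of a non-skew matrix need not be tangent, and a metric is
  constrained only on tangent vectors; inserting this projection gives forms that are linear on all
  matrices.\<close>

definition skew_part :: "real^'n^'n \<Rightarrow> real^'n^'n"
  where "skew_part X = (1 / 2) *\<^sub>R (X - transpose X)"

lemma skew_skew_part: "skew (skew_part X)"
  by (simp add: skew_def skew_part_def) (simp flip: scaleR_minus_right)

lemma skew_part_skew: "skew X \<Longrightarrow> skew_part X = X"
  by (simp add: skew_def skew_part_def flip: scaleR_2)

lemma skew_part_linear:
  "skew_part (X + Y) = skew_part X + skew_part Y" "skew_part (c *\<^sub>R X) = c *\<^sub>R skew_part X"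
  by (simp_all add: skew_part_def algebra_simps)

context
  fixes g assumes riem: "riemannian_metric g"
begin

lemma metric_rules:
  assumes "q \<in> M" "u \<in> tangent_space q" "v \<in> tangent_space q"
  shows metric_sym: "g q u v = g q v u"
    and metric_add: "w \<in> tangent_space q \<Longrightarrow> g q (u + v) w = g q u w + g q v w"
    and metric_scaleR: "g q (c *\<^sub>R u) v = c * g q u v"
    and metric_pos: "u \<noteq> 0 \<Longrightarrow> g q u u > 0"
proof -
  have *: "g q u v = g q v u \<and> (\<forall>w\<in>tangent_space q. g q (u + v) w = g q u w + g q v w) \<and>
      (\<forall>c. g q (c *\<^sub>R u) v = c * g q u v) \<and> (u \<noteq> 0 \<longrightarrow> g q u u > 0)"
    by (rule conjunct1[OF riem[unfolded riemannian_metric_def],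
          THEN bspec, OF assms(1), THEN bspec, OF assms(2), THEN bspec, OF assms(3)])
  from * show "g q u v = g q v u" ..
  from * show "w \<in> tangent_space q \<Longrightarrow> g q (u + v) w = g q u w + g q v w" by simp
  from * show "g q (c *\<^sub>R u) v = c * g q u v" by simp
  from * show "u \<noteq> 0 \<Longrightarrow> g q u u > 0" by simp
qed

lemma metric_smooth: "vector_field X \<Longrightarrow> vector_field Y \<Longrightarrow> smooth_fun (\<lambda>q. g q (X q) (Y q))"
  using conjunct2[OF riem[unfolded riemannian_metric_def]] by simp

lemma metric_diff:
  assumes "q \<in> M" "u \<in> tangent_space q" "v \<in> tangent_space q" "w \<in> tangent_space q"
  shows "g q (u - v) w = g q u w - g q v w"
  using metric_add[OF assms(1) tangent_space_linear(2)[OF assms(1-3)] assms(3,4)] by simp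

lemma metric_add_right:
  assumes "q \<in> M" "u \<in> tangent_space q" "v \<in> tangent_space q" "w \<in> tangent_space q"
  shows "g q w (u + v) = g q w u + g q w v"
  using metric_add[OF assms] metric_sym[OF assms(1,4)] tangent_space_linear(1)[OF assms(1-3)] assms
  by simp

lemma metric_zero: "q \<in> M \<Longrightarrow> v \<in> tangent_space q \<Longrightarrow> g q 0 v = 0"
  using metric_scaleR[of q v v 0] by simp

lemma linear_metric_fund:
  assumes "q \<in> M" "v \<in> tangent_space q"
  shows "linear (\<lambda>X. g q (fund (skew_part X) q) v)"
  by (rule linearI)
     (simp_all add: skew_part_linear fund_linear assms metric_add metric_scaleR fund_tangent skew_skew_part)

lemma deriv_metric_left:
  assumes q: "q \<in> M" and u: "u \<in> tangent_space q" and Y: "vector_field Y" and Z: "vector_field Z"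
  shows "u (\<lambda>p. g p (Y p) (Z p)) =
    g q (canonical q u Y) (Z q) + u (\<lambda>p. g p (fund (theta q (Y q)) p) (Z p))"
proof -
  let ?W = "\<lambda>p. theta p (Y p)"
  have sk: "skew_part (?W p) = ?W p" if "p \<in> M" for p
    by (intro skew_part_skew skew_theta vector_fieldD(1) Y that)
  have "u (\<lambda>p. g p (Y p) (Z p)) = u (\<lambda>p. g p (fund (skew_part (?W p)) p) (Z p))"
    by (rule tangent_cong[OF u]) (simp add: fund_theta vector_fieldD(1)[OF Y] sk)
  also have "\<dots> = g q (fund (skew_part (mat_deriv u ?W)) q) (Z q) +
      u (\<lambda>p. g p (fund (skew_part (?W q)) p) (Z p))"
  proof (rule product_rule(2)[OF q u])
    show "smooth_fun (\<lambda>p. g p (fund (skew_part X) p) (Z p))" for X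
      by (intro metric_smooth vector_field_fund skew_skew_part Z)
  qed (auto intro: skew_theta_field[OF Y] smooth_theta[OF Y] linear_metric_fund vector_fieldD(1)[OF Z])
  finally show ?thesis
    by (simp add: sk q canonical_def skew_part_skew[OF skew_deriv_theta[OF q u Y]])
qed

text \<open>Freezing one argument after the other leaves the metric on two fundamental fields, the
  term in which invariance will enter.\<close>

lemma deriv_metric:
  assumes q: "q \<in> M" and u: "u \<in> tangent_space q" and Y: "vector_field Y" and Z: "vector_field Z"
  shows "u (\<lambda>p. g p (Y p) (Z p)) = g q (canonical q u Y) (Z q) + g q (Y q) (canonical q u Z) +
    u (\<lambda>p. g p (fund (theta q (Y q)) p) (fund (theta q (Z q)) p))"
proof -
  let ?y = "theta q (Y q)" and ?z = "theta q (Z q)"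
  note tY = vector_fieldD(1)[OF Y q] and tZ = vector_fieldD(1)[OF Z q]
  have vy: "vector_field (fund ?y)" and vz: "vector_field (fund ?z)"
    by (intro vector_field_fund skew_theta tY tZ q)+
  have "u (\<lambda>p. g p (fund ?y p) (Z p)) = u (\<lambda>p. g p (Z p) (fund ?y p))"
    by (rule tangent_cong[OF u]) (simp add: metric_sym vector_fieldD(1)[OF Z] vector_fieldD(1)[OF vy])
  also have "\<dots> = g q (canonical q u Z) (Y q) + u (\<lambda>p. g p (fund ?z p) (fund ?y p))"
    unfolding deriv_metric_left[OF q u Z vy] by (simp add: fund_theta[OF tY q])
  also have "g q (canonical q u Z) (Y q) = g q (Y q) (canonical q u Z)"
    by (intro metric_sym q canonical_tangent u Z tY)
  also have "u (\<lambda>p. g p (fund ?z p) (fund ?y p)) = u (\<lambda>p. g p (fund ?y p) (fund ?z p))"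
    by (rule tangent_cong[OF u]) (simp add: metric_sym vector_fieldD(1)[OF vz] vector_fieldD(1)[OF vy])
  finally show ?thesis unfolding deriv_metric_left[OF q u Y Z] by simp
qed

text \<open>Since \<open>levi_civita\<close> is given by \<open>SOME\<close>, its values become
  known only through uniqueness; existence comes from \<open>canonical\<close>.\<close>

lemma levi_civita_unique:
  assumes D: "affine_connection D" "torsion_free D" "metric_compatible g D"
    and E: "affine_connection E" "torsion_free E" "metric_compatible g E"
    and q: "q \<in> M" and u: "u \<in> tangent_space q" and Y: "vector_field Y"
  shows "D q u Y = E q u Y"
proof -
  define S where "S X Y = D q (X q) Y - E q (X q) Y" for X Y
  have tan: "D q (X q) Y \<in> tangent_space q" "E q (X q) Y \<in> tangent_space q"
    if "vector_field X" "vector_field Y" for X Y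
    using D(1) E(1) q vector_fieldD(1)[OF that(1) q] that(2) unfolding affine_connection_def by blast+
  have S: "S X Y \<in> tangent_space q" if "vector_field X" "vector_field Y" for X Y
    unfolding S_def by (intro tangent_space_linear(2) q tan that)
  have sym: "S X Y = S Y X" if "vector_field X" "vector_field Y" for X Y
  proof -
    have "D q (X q) Y - D q (Y q) X = E q (X q) Y - E q (Y q) X"
      using D(2) E(2) q that unfolding torsion_free_def by simp
    from fun_cong[OF this] show ?thesis
      unfolding S_def fun_eq_iff minus_apply by (auto simp: algebra_simps)
  qed
  have alt: "g q (S X Y) (Z q) = - g q (S X Z) (Y q)"
    if v: "vector_field X" "vector_field Y" "vector_field Z" for X Y Z
  proof -
    note tg = vector_fieldD(1)[OF v(1) q] vector_fieldD(1)[OF v(2) q] vector_fieldD(1)[OF v(3) q]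
    have mc: "X q (\<lambda>p. g p (Y p) (Z p)) = g q (F q (X q) Y) (Z q) + g q (Y q) (F q (X q) Z)"
      if "metric_compatible g F" for F
      using that q tg(1) v unfolding metric_compatible_def by simp
    have "g q (D q (X q) Y) (Z q) + g q (Y q) (D q (X q) Z) =
        g q (E q (X q) Y) (Z q) + g q (Y q) (E q (X q) Z)"
      using mc[OF D(3)] mc[OF E(3)] by (rule subst)
    then show ?thesis
      unfolding S_def metric_diff[OF q tan[OF v(1,2)] tg(3)] metric_diff[OF q tan[OF v(1,3)] tg(2)]
        metric_sym[OF q tg(2) tan(1)[OF v(1,3)]] metric_sym[OF q tg(2) tan(2)[OF v(1,3)]]
      by simp
  qed
  text \<open>The form is symmetric in its first two and skew in its last two arguments, hence zero.\<close>
  have zero: "g q (S X Y) (Z q) = 0"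
    if v: "vector_field X" "vector_field Y" "vector_field Z" for X Y Z
  proof -
    have "g q (S X Y) (Z q) = g q (S Y X) (Z q)" by (simp only: sym[OF v(1,2)])
    also have "\<dots> = - g q (S Y Z) (X q)" by (rule alt[OF v(2,1,3)])
    also have "\<dots> = - g q (S Z Y) (X q)" by (simp only: sym[OF v(2,3)])
    also have "\<dots> = g q (S Z X) (Y q)" using alt[OF v(3,2,1)] by linarith
    also have "\<dots> = g q (S X Z) (Y q)" by (simp only: sym[OF v(3,1)])
    also have "\<dots> = - g q (S X Y) (Z q)" by (rule alt[OF v(1,3,2)])
    finally show ?thesis by simp
  qed
  \<comment> \<open>Fundamental fields extend single tangent vectors to vector fields. Taking the
    difference itself as third argument brings in positive definiteness.\<close>
  let ?X = "fund (theta q u)"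
  have X: "vector_field ?X" "?X q = u"
    using vector_field_fund skew_theta fund_theta u q by auto
  let ?Z = "fund (theta q (S ?X Y))"
  have Z: "vector_field ?Z" "?Z q = S ?X Y"
    using vector_field_fund skew_theta fund_theta S[OF X(1) Y] q by auto
  have "g q (S ?X Y) (S ?X Y) = 0" using zero[OF X(1) Y Z(1)] Z(2) by simp
  then have "S ?X Y = 0" using metric_pos[OF q S[OF X(1) Y] S[OF X(1) Y]] by fastforce
  then show ?thesis by (simp add: S_def X(2))
qed

context
  assumes inv: "SO5_invariant g"
begin

text \<open>By invariance the pairing at \<open>act (c t) q\<close> equals one at \<open>q\<close>
  with both coefficients conjugated back by \<open>c t\<close>: a fixed bilinear form along curves
  of matrices, where conjugation differentiates to commutators.\<close>

lemma deriv_metric_fund: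
  assumes x: "skew x" and y: "skew y" and z: "skew z" and q: "q \<in> M"
  shows "fund x q (\<lambda>p. g p (fund y p) (fund z p)) =
    g q (fund (commutator y x) q) (fund z q) + g q (fund y q) (fund (commutator z x) q)"
proof -
  obtain c where c: "\<And>t. c t \<in> SO5" "c 0 = mat 1" "(c has_vector_derivative x) (at 0)"
    using velocityE[OF velocities_SO5[OF x]] by metis
  \<comment> \<open>\<open>skew_part\<close> makes this bilinear on the whole matrix space, hence
    bounded, so the product rule for curves applies.\<close>
  define B where "B Y Z = g q (fund (skew_part Y) q) (fund (skew_part Z) q)" for Y Z
  have "linear (B Y)" for Y
  proof -
    have "B Y = (\<lambda>Z. g q (fund (skew_part Z) q) (fund (skew_part Y) q))"
      unfolding B_def by (intro ext metric_sym q fund_tangent skew_skew_part)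
    then show ?thesis
      using linear_metric_fund[OF q fund_tangent[OF skew_skew_part q]] by simp
  qed
  moreover have "linear (\<lambda>Y. B Y Z)" for Z
    unfolding B_def by (intro linear_metric_fund q fund_tangent skew_skew_part)
  ultimately have B: "bounded_bilinear B"
    by (simp flip: bilinear_conv_bounded_bilinear add: bilinear_def)
  let ?C = "\<lambda>w t. transpose (c t) ** w ** c t"
  have sC: "skew (?C w t)" if "skew w" for w t
    using skew_conj_mat[OF that, of "transpose (c t)"] by (simp add: conj_mat_def)
  have push: "fund w (act (c t) q) = push_forward (c t) (fund (?C w t) q)" if "skew w" for w t
    unfolding push_forward_fund[OF c(1) sC[OF that] q]
    by (simp add: conj_mat_def SO5_cancel[OF c(1)] SO5D(2)[OF c(1)] flip: matrix_mul_assoc)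
  have eq: "g (act (c t) q) (fund y (act (c t) q)) (fund z (act (c t) q)) = B (?C y t) (?C z t)" for t
    unfolding push[OF y] push[OF z] B_def skew_part_skew[OF sC[OF y]] skew_part_skew[OF sC[OF z]]
    using inv c(1) q fund_tangent[OF sC[OF y] q] fund_tangent[OF sC[OF z] q]
    unfolding SO5_invariant_def by blast
  have dC: "(?C w has_vector_derivative commutator w x) (at 0)" for w
  proof -
    have "(?C w has_vector_derivative transpose (c 0) ** w ** x + transpose x ** w ** c 0) (at 0)"
      by (intro bounded_bilinear.has_vector_derivative[OF bounded_bilinear_matrix_mult]
          bounded_linear.has_vector_derivative[OF bounded_linear_matmul_right]
          bounded_linear.has_vector_derivative[OF bounded_linear_transpose] c(3))
    then show ?thesis using x by (simp add: c(2) skew_def commutator_def matmul_simps)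
  qed
  have "((\<lambda>t. B (?C y t) (?C z t)) has_vector_derivative
      B (?C y 0) (commutator z x) + B (commutator y x) (?C z 0)) (at 0)"
    by (rule bounded_bilinear.has_vector_derivative[OF B dC dC])
  then have "((\<lambda>t. g (act (c t) q) (fund y (act (c t) q)) (fund z (act (c t) q))) has_real_derivative
      B y (commutator z x) + B (commutator y x) z) (at 0)"
    unfolding eq by (simp add: c(2) has_real_derivative_iff_has_vector_derivative)
  from DERIV_unique[OF this fund_path[OF metric_smooth[OF vector_field_fund[OF y] vector_field_fund[OF z]] q c]]
  show ?thesis
    by (simp add: B_def skew_part_skew skew_commutator x y z)
qed

section \<open>Levi-Civita connection and Killing fields of an invariant metric\<close>

lemma metric_compatible_canonical: "metric_compatible g canonical"
  unfolding metric_compatible_def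
proof (intro ballI allI impI)
  fix q u Y Z assume q: "q \<in> M" and u: "u \<in> tangent_space q" and Y: "vector_field Y" and Z: "vector_field Z"
  note tY = vector_fieldD(1)[OF Y q] and tZ = vector_fieldD(1)[OF Z q]
  \<comment> \<open>The commutators from \<open>deriv_metric_fund\<close> have both factors in the
    complement, so their fields vanish at \<open>q\<close>.\<close>
  have "u (\<lambda>p. g p (fund (theta q (Y q)) p) (fund (theta q (Z q)) p)) = 0"
    using deriv_metric_fund[OF skew_theta[OF u q] skew_theta[OF tY q] skew_theta[OF tZ q] q]
      metric_zero[OF q tZ] metric_zero[OF q tY] metric_sym[OF q tY tangent_space_linear(4)[OF q tY tY]]
    by (simp add: fund_theta fund_commutator_theta u tY tZ q)
  then show "u (\<lambda>p. g p (Y p) (Z p)) = g q (canonical q u Y) (Z q) + g q (Y q) (canonical q u Z)"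
    using deriv_metric[OF q u Y Z] by simp
qed

lemma levi_civita_canonical:
  assumes "q \<in> M" "u \<in> tangent_space q" "vector_field Y"
  shows "levi_civita g q u Y = canonical q u Y"
proof -
  have can: "affine_connection canonical \<and> torsion_free canonical \<and> metric_compatible g canonical"
    using affine_connection_canonical torsion_free_canonical metric_compatible_canonical by blast
  then have "affine_connection (levi_civita g) \<and> torsion_free (levi_civita g) \<and>
      metric_compatible g (levi_civita g)"
    unfolding levi_civita_def
    by (rule someI[of "\<lambda>D. affine_connection D \<and> torsion_free D \<and> metric_compatible g D"])
  with can show ?thesis using levi_civita_unique assms by blast
qed

text \<open>The derivative of the metric and the brackets with \<open>Y\<close> and \<open>Z\<close>
  split alike into canonical and commutator terms, which match one by one.\<close>

lemma killing_fund:
  assumes x: "skew x" shows "killing_field g (fund x)"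
  unfolding killing_field_def
proof (intro conjI allI impI ballI)
  show "vector_field (fund x)" by (rule vector_field_fund[OF x])
  fix Y Z q assume Y: "vector_field Y" and Z: "vector_field Z" and q: "q \<in> M"
  note tY = vector_fieldD(1)[OF Y q] and tZ = vector_fieldD(1)[OF Z q]
  note u = fund_tangent[OF x q]
  have cY: "fund (commutator (theta q (Y q)) x) q \<in> tangent_space q"
    and cZ: "fund (commutator (theta q (Z q)) x) q \<in> tangent_space q"
    by (intro fund_tangent skew_commutator skew_theta tY tZ x q)+
  show "fund x q (\<lambda>p. g p (Y p) (Z p)) =
      g q (lie_bracket (fund x) Y q) (Z q) + g q (Y q) (lie_bracket (fund x) Z q)"
    unfolding deriv_metric[OF q u Y Z] deriv_metric_fund[OF x skew_theta[OF tY q] skew_theta[OF tZ q] q]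
      fund_bracket_field[OF x Y q] fund_bracket_field[OF x Z q]
    by (simp add: metric_add metric_add_right q tY tZ cY cZ canonical_tangent u Y Z fund_theta)
qed

text \<open>The Killing field with coefficient \<open>theta q w\<close> takes the value
  \<open>w\<close> at \<open>q\<close>. Its covariant derivative there is a bracket minus a
  commutator term, and both vanish since all coefficients lie in the complement.\<close>

lemma symmetric_subspace_eq_tangent_space:
  assumes q: "q \<in> M" shows "symmetric_subspace g q = tangent_space q"
proof
  show "symmetric_subspace g q \<subseteq> tangent_space q"
    unfolding symmetric_subspace_def transvections_def killing_field_def
    using vector_fieldD(1) q by blast
  show "tangent_space q \<subseteq> symmetric_subspace g q"
  proof
    fix w assume w: "w \<in> tangent_space q"
    let ?W = "fund (theta q w)"
    note skw = skew_theta[OF w q]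
    have "levi_civita g q u ?W = 0" if u: "u \<in> tangent_space q" for u
    proof -
      note sku = skew_theta[OF u q]
      have "lie_bracket (fund (theta q u)) ?W q = 0"
        unfolding fund_bracket[OF sku skw q] by (rule fund_commutator_theta[OF w q u])
      then have "canonical q u ?W = 0"
        using fund_bracket_field[OF sku vector_field_fund[OF skw] q]
        by (simp add: fund_theta[OF u q] fund_theta[OF w q] fund_commutator_theta[OF w q u])
      then show ?thesis
        using levi_civita_canonical[OF q u vector_field_fund[OF skw]] by simp
    qed
    then have "?W \<in> transvections g q"
      unfolding transvections_def using killing_fund[OF skw] by simp
    then show "w \<in> symmetric_subspace g q"
      unfolding symmetric_subspace_def using fund_theta[OF w q] by (metis image_eqI)
  qed
qed

end

end

theorem proposition3p3:
  shows "\<not> (\<exists>g. riemannian_metric g \<and> SO5_invariant g \<and>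
           (\<exists>q\<in>M. coindex_of_symmetry g q = 4))"
proof -
  \<comment> \<open>Both \<open>dim\<close> terms concern the same set, so the difference is 0
    whatever the dimension is.\<close>
  have "coindex_of_symmetry g q = 0" if "riemannian_metric g" "SO5_invariant g" "q \<in> M" for g q
    using symmetric_subspace_eq_tangent_space[OF that]
    by (simp add: coindex_of_symmetry_def index_of_symmetry_def)
  then show ?thesis by fastforce
qed

end
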